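(* Let $S\subset E^3$ be a surface of revolution parametrized by $r(t,u)=(f(u)\cos t,f(u)\sin t,g(u))$, $u\in I$, $t\in[0,2\pi]$, where $I\subset\mathbb{R}$ is an open interval, $f>0$ on $I$, and $(f')^2+(g')^2=1$ on $I$. Assume that $f'(u)\neq 0$ and $f''(u)\neq 0$ for each $u\in I$. Let $U$ be an open connected subset of $S$. Then there exists a map $\Phi:U\to E^2$ having the properties (C1) $\Phi$ sends the meridional arcs of $S\cap U$ to straight lines of $E^2$; (C2) $\Phi$ preserves distances infinitesimally along the meridians and the parallels of $S$; if and only if $f^2=cu^2+du+k$, where $c,d,k$ are real constants with $k>0$ and $c>0$. Furthermore, for such a map $\Phi(t,u)=(x(t,u),y(t,u))$ there are real constants $\theta_0,c_0$ such that $$x(t,u)=u\cos(b(t))+\int\sqrt{k}\cos(\theta_0-b(t))\,dt,$$ $$y(t,u)=-u\sin(b(t))+\int\sqrt{k}\sin(\theta_0-b(t))\,dt,$$ where $b(t)=-\sqrt{c}\,t+c_0$ and $\int\cdots dt$ denotes an antiderivative with respect to $t$.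
   Context: $E^2$ and $E^3$ are the Euclidean plane and Euclidean 3-space. All maps (including $f,g,\Phi$) are assumed to be of class $C^s$ with $s\ge 2$. The Riemannian metric of $S$ is $ds^2=du^2+f^2(u)\,dt^2$. For fixed $t$, the $u$-curves $r(t,\cdot)$ are called meridians; for fixed $u$, the $t$-curves $r(\cdot,u)$ are called parallels. A point $p=r(t,u)$ of $S$ is identified with its coordinate pair $(t,u)$, $t\in[0,2\pi)$, and a map $\Phi$ on $U$ is written in coordinates as $\Phi(t,u)=(x(t,u),y(t,u))$. Meridional arcs of $S\cap U$ are arcs of meridians contained in $U$; (C1) means each of them is mapped into a straight line of $E^2$. Condition (C2) means that, on $U$, $$\sqrt{\left(\tfrac{\partial x}{\partial u}\right)^2+\left(\tfrac{\partial y}{\partial u}\right)^2}=1,\qquad \sqrt{\left(\tfrac{\partial x}{\partial t}\right)^2+\left(\tfrac{\partial y}{\partial t}\right)^2}=f(u).$$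
   Formalization: The quadratic identity is claimed for u occurring in U, with the needed extra condition d²≤4ck; b(t)=∓√c t+c₀ with either sign; Φ is C^s in coordinates t∈[0,2π), and the formula holds on each connected component of U's coordinate set, with its own constants and sign. *)

theory Defs
  imports "HOL-Analysis.Analysis"
begin

text \<open>
  Class $C^n$ on a set \<open>D\<close>, by iterated directional derivatives.  All derivatives are taken
  within \<open>D\<close>.  On open sets this is the usual notion; on a relatively open subset of a half plane
  (where derivatives within the set are still unique) they are one-sided at boundary points.
\<close>

primrec C_class_on ::
  "nat \<Rightarrow> 'a::real_normed_vector set \<Rightarrow> ('a \<Rightarrow> 'b::real_normed_vector) \<Rightarrow> bool" where
  "C_class_on 0 D h \<longleftrightarrow> continuous_on D h"
| "C_class_on (Suc n) D h \<longleftrightarrow>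
     (\<exists>h'. (\<forall>p\<in>D. (h has_derivative h' p) (at p within D)) \<and>
           (\<forall>v. C_class_on n D (\<lambda>p. h' p v)))"

definition rev_param :: "(real \<Rightarrow> real) \<Rightarrow> (real \<Rightarrow> real) \<Rightarrow> real \<Rightarrow> real \<Rightarrow> real^3" where
  "rev_param f g t u = vector [f u * cos t, f u * sin t, g u]"

definition rev_surface :: "(real \<Rightarrow> real) \<Rightarrow> (real \<Rightarrow> real) \<Rightarrow> real set \<Rightarrow> (real^3) set" where
  "rev_surface f g I = {rev_param f g t u | t u. t \<in> {0..2 * pi} \<and> u \<in> I}"

text \<open>
  The coordinate pairs of the points of \<open>U\<close>.  The angle lies in $[0,2\pi)$, so the surface is cut
  open along the meridian \<open>t = 0\<close>.
\<close>

definition coords ::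
  "(real \<Rightarrow> real) \<Rightarrow> (real \<Rightarrow> real) \<Rightarrow> real set \<Rightarrow> (real^3) set \<Rightarrow> (real \<times> real) set" where
  "coords f g I U = {(t, u). t \<in> {0..<2 * pi} \<and> u \<in> I \<and> rev_param f g t u \<in> U}"

definition meridians_to_lines ::
  "(real \<Rightarrow> real) \<Rightarrow> (real \<Rightarrow> real) \<Rightarrow> real set \<Rightarrow> (real^3) set \<Rightarrow> (real^3 \<Rightarrow> real^2) \<Rightarrow> bool" where
  "meridians_to_lines f g I U \<Phi> \<longleftrightarrow>
     (\<forall>t\<in>{0..<2 * pi}. \<forall>K. is_interval K \<and> K \<subseteq> I \<and> rev_param f g t ` K \<subseteq> U \<longrightarrow>
        (\<exists>L. affine L \<and> aff_dim L = 1 \<and> \<Phi> ` rev_param f g t ` K \<subseteq> L))"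

text \<open>
  The derivative in \<open>t\<close> is taken within $[0,2\pi)$: it is the ordinary derivative for \<open>t > 0\<close> and
  the right derivative at \<open>t = 0\<close>.
\<close>

definition preserves_metric_on_coordinate_curves ::
  "(real \<Rightarrow> real) \<Rightarrow> (real \<Rightarrow> real) \<Rightarrow> real set \<Rightarrow> (real^3) set \<Rightarrow> (real^3 \<Rightarrow> real^2) \<Rightarrow> bool" where
  "preserves_metric_on_coordinate_curves f g I U \<Phi> \<longleftrightarrow>
     (let x = (\<lambda>t u. \<Phi> (rev_param f g t u) $ 1);
          y = (\<lambda>t u. \<Phi> (rev_param f g t u) $ 2);
          D\<^sub>u = (\<lambda>h t u. deriv (h t) u);
          D\<^sub>t = (\<lambda>h t u. vector_derivative (\<lambda>\<tau>. h \<tau> u) (at t within {0..<2 * pi}))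
      in \<forall>(t, u)\<in>coords f g I U.
           sqrt ((D\<^sub>u x t u)\<^sup>2 + (D\<^sub>u y t u)\<^sup>2) = (1::real) \<and>
           sqrt ((D\<^sub>t x t u)\<^sup>2 + (D\<^sub>t y t u)\<^sup>2) = f u)"

definition admissible_map ::
  "nat \<Rightarrow> (real \<Rightarrow> real) \<Rightarrow> (real \<Rightarrow> real) \<Rightarrow> real set \<Rightarrow> (real^3) set \<Rightarrow> (real^3 \<Rightarrow> real^2) \<Rightarrow> bool"
where
  "admissible_map s f g I U \<Phi> \<longleftrightarrow>
     C_class_on s (coords f g I U) (\<lambda>(t, u). \<Phi> (rev_param f g t u)) \<and>
     meridians_to_lines f g I U \<Phi> \<and>
     preserves_metric_on_coordinate_curves f g I U \<Phi>"

end

theory Submission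
  imports Defs
begin

text \<open>
  Identify the plane with the complex numbers and write \<open>Z\<close> for the map in coordinates.  Since meridians
  go to lines at unit speed, $E = Z_u$ does not depend on \<open>u\<close> locally, so $Z = P(t) + u E(t)$ and
  $f^2 = |E'|^2 u^2 + 2 \mathrm{Re}(P' \overline{E'}) u + |P'|^2$.  Cauchy-Schwarz gives $d^2 \le 4ck$, and
  $c = 0$ or $k = 0$ would make $f$ constant or linear.  Conversely, when the coefficients are fixed,
  $E'/E$ is one of $\pm i \sqrt{c}$ and $P'/E$ takes at most two values, so by continuity
  both quotients are constant on each component; integrating $E' = \pm i \sqrt{c} E$ and
  $P' = w E$ with $|w|^2 = k$ gives the explicit formula.
\<close>

text \<open>The angle is cut at t = 0, so a connected \<open>U\<close> may have a disconnected
  coordinate domain \<open>D\<close>, relatively open in the strip [0, 2 pi) x R. This separates two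
  kinds of data. The coefficients c, d, k belong to f alone: the u-values occurring in
  \<open>D\<close> are those u for which f(u) is the distance of some point of \<open>U\<close> from
  the axis, so they form an interval, and one quadratic serves all components. Signs and integration
  constants belong to the map and may change from one component to the next. A meridian can also
  meet \<open>U\<close> in several arcs, so independence of u is only available locally. Statements
  on a whole component are therefore drawn from expressions whose full derivative vanishes on a
  connected set, not from integration along coordinate lines. In the converse the discriminant
  inequality returns as the solvability condition for w: |w|^2 = k and Im w = d / (2 sqrt c) have a
  common solution exactly when d^2 \<le> 4ck.\<close>

section \<open>Calculus on relatively open subsets of a strip\<close>

lemma rel_open_strip_box:
  assumes "openin (top_of_set (R \<times> UNIV)) D" and "(t, u) \<in> D"
  obtains \<delta> where "\<delta> > 0" and "(R \<inter> ball t \<delta>) \<times> ball u \<delta> \<subseteq> D"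
    and "(R \<inter> ball t \<delta>) \<times> ball u \<delta> = D \<inter> ball t \<delta> \<times> ball u \<delta>"
proof -
  obtain T where T: "open T" "D = (R \<times> UNIV) \<inter> T"
    using assms(1) by (auto simp: openin_open)
  obtain A B where AB: "open A" "open B" "t \<in> A" "u \<in> B" "A \<times> B \<subseteq> T"
    using open_prod_elim[OF T(1), of "(t, u)"] T(2) assms(2)
    by (metis IntD2 mem_Sigma_iff)
  obtain d1 d2 where d: "d1 > 0" "ball t d1 \<subseteq> A" "d2 > 0" "ball u d2 \<subseteq> B"
    using AB by (metis open_contains_ball)
  define \<delta> where "\<delta> = min d1 d2"
  have "ball t \<delta> \<subseteq> A" "ball u \<delta> \<subseteq> B" "\<delta> > 0"
    using d by (auto simp: \<delta>_def)
  then have "(R \<inter> ball t \<delta>) \<times> ball u \<delta> \<subseteq> D" "\<delta> > 0"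
      and "(R \<inter> ball t \<delta>) \<times> ball u \<delta> = D \<inter> ball t \<delta> \<times> ball u \<delta>"
    using AB(5) T(2) by auto
  then show thesis using that by blast
qed

text \<open>\<open>D\<close> need not be open in the plane, but each of its points has a convex box
  as a relative neighbourhood. On such a box a zero derivative forces constancy, so \<open>h\<close>
  is locally constant, and connectedness of \<open>V\<close> does the rest.\<close>

lemma zero_derivative_constant:
  fixes h :: "real \<times> real \<Rightarrow> 'b::real_normed_vector"
  assumes "openin (top_of_set (R \<times> UNIV)) D" and "convex R"
    and h: "\<And>p. p \<in> D \<Longrightarrow> (h has_derivative (\<lambda>_. 0)) (at p within D)"
    and V: "connected V" "V \<subseteq> D" "p \<in> V" "q \<in> V"
  shows "h p = h q"
proof (rule connected_local_const[OF V(1,3,4)], rule ballI)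
  fix a assume "a \<in> V"
  obtain t u where a: "a = (t, u)" by fastforce
  with \<open>a \<in> V\<close> V(2) have "(t, u) \<in> D" by auto
  then obtain \<delta> where \<delta>: "\<delta> > 0" "(R \<inter> ball t \<delta>) \<times> ball u \<delta> \<subseteq> D"
    "(R \<inter> ball t \<delta>) \<times> ball u \<delta> = D \<inter> ball t \<delta> \<times> ball u \<delta>"
    using rel_open_strip_box[OF assms(1)] by metis
  let ?B = "(R \<inter> ball t \<delta>) \<times> ball u \<delta>"
  have "convex ?B"
    by (intro convex_Times convex_Int assms convex_ball)
  moreover have "(h has_derivative (\<lambda>_. 0)) (at x within ?B)" if "x \<in> ?B" for x
    using h \<delta>(2) that has_derivative_subset by blast
  ultimately obtain c where c: "\<forall>x\<in>?B. h x = c"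
    using has_derivative_zero_constant by metis
  have "eventually (\<lambda>b. b \<in> ball t \<delta> \<times> ball u \<delta>) (nhds a)"
    using \<delta>(1) a by (intro eventually_nhds_in_open open_Times) auto
  then have "eventually (\<lambda>b. b \<in> ball t \<delta> \<times> ball u \<delta>) (at a within V)"
    by (auto simp: eventually_at_filter elim: eventually_mono)
  moreover have "eventually (\<lambda>b. b \<in> V) (at a within V)"
    by (simp add: eventually_at_filter)
  ultimately show "eventually (\<lambda>b. h a = h b) (at a within V)"
  proof eventually_elim
    case (elim b)
    then have "b \<in> ?B" and "a \<in> ?B" using V(2) \<delta>(1) \<open>a \<in> V\<close> a unfolding \<delta>(3) by auto
    then show ?case using bspec[OF c, of a] bspec[OF c, of b] by simp
  qed
qed

lemma has_vector_derivative_locally_const: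
  fixes h :: "real \<Rightarrow> 'b::real_normed_vector"
  assumes "eventually (\<lambda>x. h x = c) (nhds a)"
  shows "(h has_vector_derivative 0) (at a)"
proof -
  obtain S where S: "open S" "a \<in> S" "\<And>x. x \<in> S \<Longrightarrow> h x = c"
    using assms by (auto simp: eventually_nhds)
  show ?thesis
    by (rule has_vector_derivative_transform_within_open[OF has_vector_derivative_const S(1,2)])
       (simp add: S(3))
qed

text \<open>The two partial derivatives differ in kind: here the derivative is taken within
  \<open>R\<close>, hence one-sided at an endpoint belonging to \<open>R\<close>, whereas in the
  direction of u the box is a full ball and the derivative is two-sided.\<close>

lemma partial_fst:
  assumes "openin (top_of_set (R \<times> UNIV)) D" and "(t, u) \<in> D"
    and "(h has_derivative h') (at (t, u) within D)"
  shows "((\<lambda>\<tau>. h (\<tau>, u)) has_vector_derivative h' (1, 0)) (at t within R)"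
proof -
  obtain \<delta> where \<delta>: "\<delta> > 0" "(R \<inter> ball t \<delta>) \<times> ball u \<delta> \<subseteq> D"
    using rel_open_strip_box[OF assms(1,2)] by metis
  let ?S = "R \<inter> ball t \<delta>"
  have "((\<lambda>\<tau>. (\<tau>, u)) has_derivative (\<lambda>s. (s, 0))) (at t within ?S)"
    by (auto intro!: derivative_eq_intros)
  moreover have "(h has_derivative h') (at (t, u) within (\<lambda>\<tau>. (\<tau>, u)) ` ?S)"
    by (rule has_derivative_subset[OF assms(3)]) (use \<delta> in auto)
  ultimately have "((\<lambda>\<tau>. h (\<tau>, u)) has_derivative (\<lambda>s. h' (s, 0))) (at t within ?S)"
    by (rule has_derivative_in_compose)
  moreover have "(\<lambda>s. h' (s, 0)) = (\<lambda>s. s *\<^sub>R h' (1, 0))"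
  proof
    fix s show "h' (s, 0) = s *\<^sub>R h' (1, 0)"
      using linear_scale[OF has_derivative_linear[OF assms(3)], of s "(1, 0)"] by simp
  qed
  ultimately have "((\<lambda>\<tau>. h (\<tau>, u)) has_vector_derivative h' (1, 0)) (at t within ?S)"
    by (simp add: has_vector_derivative_def)
  moreover have "at t within ?S = at t within R"
    by (rule at_within_nhd[of _ "ball t \<delta>"]) (use \<delta> in auto)
  ultimately show ?thesis by simp
qed

lemma partial_snd:
  assumes "openin (top_of_set (R \<times> UNIV)) D" and "(t, u) \<in> D"
    and "(h has_derivative h') (at (t, u) within D)"
  shows "((\<lambda>\<upsilon>. h (t, \<upsilon>)) has_vector_derivative h' (0, 1)) (at u)"
proof -
  have tR: "t \<in> R" using assms(1,2) openin_imp_subset by fastforce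
  obtain \<delta> where \<delta>: "\<delta> > 0" "(R \<inter> ball t \<delta>) \<times> ball u \<delta> \<subseteq> D"
    using rel_open_strip_box[OF assms(1,2)] by metis
  let ?S = "ball u \<delta>"
  have "((\<lambda>\<upsilon>. (t, \<upsilon>)) has_derivative (\<lambda>s. (0, s))) (at u within ?S)"
    by (auto intro!: derivative_eq_intros)
  moreover have "(h has_derivative h') (at (t, u) within (\<lambda>\<upsilon>. (t, \<upsilon>)) ` ?S)"
    by (rule has_derivative_subset[OF assms(3)]) (use \<delta> tR in auto)
  ultimately have "((\<lambda>\<upsilon>. h (t, \<upsilon>)) has_derivative (\<lambda>s. h' (0, s))) (at u within ?S)"
    by (rule has_derivative_in_compose)
  moreover have "(\<lambda>s. h' (0, s)) = (\<lambda>s. s *\<^sub>R h' (0, 1))"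
  proof
    fix s show "h' (0, s) = s *\<^sub>R h' (0, 1)"
      using linear_scale[OF has_derivative_linear[OF assms(3)], of s "(0, 1)"] by simp
  qed
  ultimately have "((\<lambda>\<upsilon>. h (t, \<upsilon>)) has_vector_derivative h' (0, 1)) (at u within ?S)"
    by (simp add: has_vector_derivative_def)
  moreover have "at u within ?S = at u"
    by (rule at_within_open) (use \<delta> in auto)
  ultimately show ?thesis by simp
qed

section \<open>Local form of the map and of f^2\<close>

lemma quadratic_coeffs_unique:
  fixes a c d k c' d' k' :: real
  assumes "eventually (\<lambda>u. c * u\<^sup>2 + d * u + k = c' * u\<^sup>2 + d' * u + k') (nhds a)"
  shows "c = c'" and "d = d'" and "k = k'"
proof -
  obtain e where e: "e > 0"
    "\<And>u. dist u a < e \<Longrightarrow> c * u\<^sup>2 + d * u + k = c' * u\<^sup>2 + d' * u + k'"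
    using assms by (auto simp: eventually_nhds_metric)
  \<comment> \<open>The quadratics are compared at a - h, a and a + h. The second difference
    isolates the leading coefficient, the difference of the outer values then isolates the linear
    one.\<close>
  define h where "h = e / 2"
  have h: "h > 0" "dist (a + h) a < e" "dist (a - h) a < e" "dist a a < e"
    using e(1) by (auto simp: h_def dist_real_def)
  note q = e(2)[OF h(2)] e(2)[OF h(3)] e(2)[OF h(4)]
  have "2 * ((c - c') * (h * h)) = 0"
    using q by (simp only: power2_eq_square) (algebra)
  then show c: "c = c'" using h(1) by simp
  have "2 * ((d - d') * h) = 0"
    using q(1,2) unfolding c power2_eq_square by algebra
  then show d: "d = d'" using h(1) by simp
  show "k = k'" using q(3) c d by simp
qed

text \<open>
  \<open>R\<close> is the half-open angle interval, so all derivatives at \<open>t = 0\<close> are one-sided.  \<open>E'\<close> is the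
  full derivative of $E = Z_u$, and \<open>Pt\<close> below stands for $P' = Z_t - u E_t$.
\<close>

locale ruled_map =
  fixes R :: "real set" and D :: "(real \<times> real) set" and f :: "real \<Rightarrow> real"
    and Z :: "real \<times> real \<Rightarrow> complex"
    and Z' E' :: "real \<times> real \<Rightarrow> real \<times> real \<Rightarrow> complex"
  assumes convex_R: "convex R"
    and R_perfect: "\<And>t. t \<in> R \<Longrightarrow> at t within R \<noteq> bot"
    and D_open: "openin (top_of_set (R \<times> UNIV)) D"
    and Z_deriv: "\<And>p. p \<in> D \<Longrightarrow> (Z has_derivative Z' p) (at p within D)"
    and E_deriv: "\<And>p. p \<in> D \<Longrightarrow> ((\<lambda>p. Z' p (0, 1)) has_derivative E' p) (at p within D)"
    and Zt_cont: "continuous_on D (\<lambda>p. Z' p (1, 0))"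
    and Et_cont: "continuous_on D (\<lambda>p. E' p (1, 0))"
    and norm_E: "\<And>p. p \<in> D \<Longrightarrow> cmod (Z' p (0, 1)) = 1"
    and norm_Zt: "\<And>p. p \<in> D \<Longrightarrow> cmod (Z' p (1, 0)) = f (snd p)"
    and lines: "\<And>t K. is_interval K \<Longrightarrow> {t} \<times> K \<subseteq> D \<Longrightarrow> collinear (Z ` ({t} \<times> K))"
begin

abbreviation "E p \<equiv> Z' p (0, 1)"
abbreviation "Zt p \<equiv> Z' p (1, 0)"
abbreviation "Et p \<equiv> E' p (1, 0)"

definition "Pt p = Zt p - of_real (snd p) * Et p"

text \<open>The image of the segment has a direction \<open>w\<close>, so Im((Z - Z0) cnj w)
  vanishes identically and its derivative shows that \<open>E\<close> is a real multiple of
  \<open>w\<close>. Unit length leaves only a sign, and continuity of \<open>E\<close> on the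
  connected ball rules out a change of sign.\<close>

lemma E_const:
  assumes "{t} \<times> ball u0 \<delta> \<subseteq> D" and u: "u \<in> ball u0 \<delta>"
  shows "E (t, u) = E (t, u0)"
proof -
  let ?B = "ball u0 \<delta>"
  have "\<delta> > 0" using u le_less_trans[OF zero_le_dist[of u0 u]] by simp
  have D: "(t, \<upsilon>) \<in> D" if "\<upsilon> \<in> ?B" for \<upsilon> using assms that by auto
  have u0: "u0 \<in> ?B" using \<open>\<delta> > 0\<close> by simp
  have ev: "eventually (\<lambda>u. u \<in> ?B) (nhds \<upsilon>)" if "\<upsilon> \<in> ?B" for \<upsilon>
    using that by (intro eventually_nhds_in_open) auto
  have Zu: "((\<lambda>\<upsilon>. Z (t, \<upsilon>)) has_vector_derivative E (t, \<upsilon>)) (at \<upsilon>)" if "\<upsilon> \<in> ?B" for \<upsilon>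
    using partial_snd[OF D_open D[OF that] Z_deriv[OF D[OF that]]] .
  have "is_interval ?B" by (simp add: is_interval_convex_1)
  from lines[OF this assms(1)] obtain w
    where w: "\<And>x y. x \<in> Z ` ({t} \<times> ?B) \<Longrightarrow> y \<in> Z ` ({t} \<times> ?B) \<Longrightarrow> \<exists>c. x - y = c *\<^sub>R w"
    unfolding collinear_def by metis
  have w0: "\<exists>c. Z (t, \<upsilon>) - Z (t, u0) = c *\<^sub>R w" if "\<upsilon> \<in> ?B" for \<upsilon>
    by (rule w) (use that u0 in blast)+
  have real: "Im (E (t, \<upsilon>) * cnj w) = 0" if \<upsilon>: "\<upsilon> \<in> ?B" for \<upsilon>
  proof -
    have "((\<lambda>\<upsilon>. Im ((Z (t, \<upsilon>) - Z (t, u0)) * cnj w)) has_vector_derivative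
        Im (E (t, \<upsilon>) * cnj w)) (at \<upsilon>)"
      by (rule bounded_linear.has_vector_derivative[OF bounded_linear_Im])
         (auto intro!: derivative_eq_intros Zu[OF \<upsilon>])
    moreover have "Im ((Z (t, \<upsilon>) - Z (t, u0)) * cnj w) = 0" if "\<upsilon> \<in> ?B" for \<upsilon>
    proof -
      obtain c where c: "Z (t, \<upsilon>) - Z (t, u0) = c *\<^sub>R w"
        using w0 \<open>\<upsilon> \<in> ?B\<close> by blast
      show ?thesis unfolding c by (simp add: algebra_simps)
    qed
    then have "((\<lambda>\<upsilon>. Im ((Z (t, \<upsilon>) - Z (t, u0)) * cnj w)) has_vector_derivative 0) (at \<upsilon>)"
      by (intro has_vector_derivative_locally_const eventually_mono[OF ev[OF \<upsilon>]])
    ultimately show ?thesis by (rule vector_derivative_unique_at)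
  qed
  \<comment> \<open>A set consisting of one point is also \<open>collinear\<close>, with w = 0; unit
    speed excludes that case.\<close>
  have "w \<noteq> 0"
  proof
    assume "w = 0"
    then have "Z (t, \<upsilon>) = Z (t, u0)" if "\<upsilon> \<in> ?B" for \<upsilon>
      using w0[OF that] by simp
    then have "((\<lambda>\<upsilon>. Z (t, \<upsilon>)) has_vector_derivative 0) (at u0)"
      by (intro has_vector_derivative_locally_const eventually_mono[OF ev[OF u0]])
    from vector_derivative_unique_at[OF Zu[OF u0] this] have "E (t, u0) = 0" .
    with norm_E[OF D[OF u0]] show False by simp
  qed
  have E0: "E (t, u0) \<noteq> 0" using norm_E[OF D[OF u0]] by auto
  define q where "q \<upsilon> = E (t, \<upsilon>) / E (t, u0)" for \<upsilon>
  have "q \<upsilon> \<in> {1, -1}" if \<upsilon>: "\<upsilon> \<in> ?B" for \<upsilon>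
  proof -
    have "E (t, \<upsilon>) * cnj w / (E (t, u0) * cnj w) \<in> \<real>"
      using real[OF \<upsilon>] real[OF u0] by (intro Reals_divide) (simp_all only: complex_is_Real_iff)
    then have "q \<upsilon> \<in> \<real>"
      using \<open>w \<noteq> 0\<close> by (simp add: q_def)
    then obtain r where r: "q \<upsilon> = of_real r" by (auto elim: Reals_cases)
    moreover have "cmod (q \<upsilon>) = 1"
      using norm_E[OF D[OF u0]] norm_E[OF D[OF \<upsilon>]] by (simp add: q_def norm_divide)
    ultimately have "\<bar>r\<bar> = 1" by simp
    then show ?thesis using r by (auto simp: abs_if split: if_splits)
  qed
  then have "finite (q ` ?B)" by (meson finite.emptyI finite.insertI finite_subset image_subsetI)
  moreover have "continuous_on ?B q"
  proof -
    have "continuous_on D (\<lambda>p. E p)"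
      using E_deriv by (meson has_derivative_continuous_on)
    then have "continuous_on ?B (\<lambda>\<upsilon>. E (t, \<upsilon>))"
      by (rule continuous_on_compose2[of D _ _ "\<lambda>\<upsilon>. (t, \<upsilon>)"])
         (auto intro!: continuous_intros simp: D[unfolded mem_ball])
    then show ?thesis unfolding q_def using E0 by (auto intro!: continuous_intros)
  qed
  ultimately have "q constant_on ?B"
    by (intro continuous_finite_range_constant) (auto intro: convex_connected)
  then have "q u = q u0" using u u0 by (auto simp: constant_on_def)
  then show ?thesis using E0 by (simp add: q_def)
qed

text \<open>On a whole box \<open>E\<close> does not depend on u, so the t-derivatives of
  \<open>E\<close> at heights u and u0 agree. Integrating in u and then differentiating in t gives
  \<open>Zt\<close> at height u as \<open>Zt\<close> at u0 plus (u - u0) \<open>Et\<close>, which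
  says that \<open>Pt\<close> is unchanged. No interchange of mixed second derivatives is
  involved.\<close>

lemma local_form:
  assumes "(t, u0) \<in> D"
  shows "E' (t, u0) (0, 1) = 0"
    and "eventually (\<lambda>u. (t, u) \<in> D \<and> Et (t, u) = Et (t, u0) \<and> Pt (t, u) = Pt (t, u0)) (nhds u0)"
proof -
  obtain \<delta> where \<delta>: "\<delta> > 0" "(R \<inter> ball t \<delta>) \<times> ball u0 \<delta> \<subseteq> D"
    using rel_open_strip_box[OF D_open assms] by metis
  have "t \<in> R" using assms D_open openin_imp_subset by fastforce
  let ?B = "ball u0 \<delta>" and ?S = "R \<inter> ball t \<delta>"
  have u0: "u0 \<in> ?B" and tS: "t \<in> ?S" using \<delta> \<open>t \<in> R\<close> by auto
  have D: "(\<tau>, u) \<in> D" if "\<tau> \<in> ?S" "u \<in> ?B" for \<tau> u using \<delta>(2) that by blast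
  have E: "E (\<tau>, u) = E (\<tau>, u0)" if "\<tau> \<in> ?S" "u \<in> ?B" for \<tau> u
    by (rule E_const[of _ _ \<delta>]) (use D that in auto)
  have ev: "eventually (\<lambda>u. u \<in> ?B) (nhds u0)"
    using u0 by (intro eventually_nhds_in_open) auto
  have "((\<lambda>u. E (t, u)) has_vector_derivative 0) (at u0)"
    by (rule has_vector_derivative_locally_const[OF eventually_mono[OF ev E[OF tS]]])
  from vector_derivative_unique_at[OF partial_snd[OF D_open assms E_deriv[OF assms]] this]
  show "E' (t, u0) (0, 1) = 0" .
  \<comment> \<open>This is proved for all \<tau> near t, not only for t itself, because both sides
    are differentiated in \<tau> afterwards.\<close>
  have Z: "Z (\<tau>, u) = Z (\<tau>, u0) + (u - u0) *\<^sub>R E (\<tau>, u0)" if "\<tau> \<in> ?S" "u \<in> ?B" for \<tau> u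
  proof -
    have "((\<lambda>\<upsilon>. Z (\<tau>, \<upsilon>) - (\<upsilon> - u0) *\<^sub>R E (\<tau>, u0)) has_derivative (\<lambda>_. 0)) (at x within ?B)"
      if x: "x \<in> ?B" for x
    proof -
      have "((\<lambda>\<upsilon>. Z (\<tau>, \<upsilon>)) has_vector_derivative E (\<tau>, x)) (at x)"
        by (rule partial_snd[OF D_open _ Z_deriv]) (use D[OF \<open>\<tau> \<in> ?S\<close> x] in auto)
      then have "((\<lambda>\<upsilon>. Z (\<tau>, \<upsilon>) - (\<upsilon> - u0) *\<^sub>R E (\<tau>, u0)) has_vector_derivative 0) (at x)"
        unfolding E[OF \<open>\<tau> \<in> ?S\<close> x] by (auto intro!: derivative_eq_intros)
      then show ?thesis
        by (simp add: has_vector_derivative_def has_derivative_at_withinI)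
    qed
    then have "\<exists>c. \<forall>x\<in>?B. Z (\<tau>, x) - (x - u0) *\<^sub>R E (\<tau>, u0) = c"
      by (intro has_derivative_zero_constant convex_ball)
    then obtain c where c: "\<And>x. x \<in> ?B \<Longrightarrow> Z (\<tau>, x) - (x - u0) *\<^sub>R E (\<tau>, u0) = c"
      by blast
    have "Z (\<tau>, u) - (u - u0) *\<^sub>R E (\<tau>, u0) = Z (\<tau>, u0) - (u0 - u0) *\<^sub>R E (\<tau>, u0)"
      using c[OF that(2)] c[OF u0] by simp
    then show ?thesis by (simp add: algebra_simps)
  qed
  show "eventually (\<lambda>u. (t, u) \<in> D \<and> Et (t, u) = Et (t, u0) \<and> Pt (t, u) = Pt (t, u0)) (nhds u0)"
    using ev
  proof eventually_elim
    case (elim u)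
    note uniq = vector_derivative_unique_within[OF R_perfect[OF \<open>t \<in> R\<close>]]
    have Du: "(t, u) \<in> D" using D tS elim by blast
    have 1: "((\<lambda>\<tau>. E (\<tau>, u0)) has_vector_derivative Et (t, u0)) (at t within R)"
      by (rule partial_fst[OF D_open assms E_deriv[OF assms]])
    have 2: "((\<lambda>\<tau>. Z (\<tau>, u0)) has_vector_derivative Zt (t, u0)) (at t within R)"
      by (rule partial_fst[OF D_open assms Z_deriv[OF assms]])
    have "((\<lambda>\<tau>. E (\<tau>, u)) has_vector_derivative Et (t, u0)) (at t within R)"
      by (rule has_vector_derivative_transform_within[OF 1 \<delta>(1) \<open>t \<in> R\<close>])
         (use E elim in \<open>simp add: dist_commute\<close>)
    then have Et: "Et (t, u) = Et (t, u0)"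
      by (rule uniq[OF partial_fst[OF D_open Du E_deriv[OF Du]]])
    have "((\<lambda>\<tau>. Z (\<tau>, u0) + (u - u0) *\<^sub>R E (\<tau>, u0)) has_vector_derivative
        Zt (t, u0) + (u - u0) *\<^sub>R Et (t, u0)) (at t within R)"
      by (auto intro!: derivative_eq_intros 1 2)
    then have "((\<lambda>\<tau>. Z (\<tau>, u)) has_vector_derivative
        Zt (t, u0) + (u - u0) *\<^sub>R Et (t, u0)) (at t within R)"
      by (rule has_vector_derivative_transform_within[OF _ \<delta>(1) \<open>t \<in> R\<close>])
         (use Z elim in \<open>simp add: dist_commute\<close>)
    then have "Zt (t, u) = Zt (t, u0) + (u - u0) *\<^sub>R Et (t, u0)"
      by (rule uniq[OF partial_fst[OF D_open Du Z_deriv[OF Du]]])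
    then show ?case using Du Et by (simp add: Pt_def scaleR_conv_of_real algebra_simps)
  qed
qed

text \<open>The coefficients stay frozen at (t, u0) while u varies; \<open>local_form\<close>
  supplies this, and it makes the identity a genuine quadratic in u.\<close>

lemma local_quadratic:
  assumes "(t, u0) \<in> D"
  shows "eventually (\<lambda>u. (f u)\<^sup>2 = (cmod (Et (t, u0)))\<^sup>2 * u\<^sup>2 +
           2 * Re (Pt (t, u0) * cnj (Et (t, u0))) * u + (cmod (Pt (t, u0)))\<^sup>2) (nhds u0)"
  using local_form(2)[OF assms]
proof eventually_elim
  case (elim u)
  then have "Zt (t, u) = Pt (t, u0) + of_real u * Et (t, u0)"
    by (metis Pt_def snd_conv diff_add_cancel)
  then have "f u = cmod (Pt (t, u0) + of_real u * Et (t, u0))"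
    using norm_Zt[of "(t, u)"] elim by simp
  then show ?case
    by (simp only: cmod_power2) (simp add: power2_eq_square algebra_simps)
qed

text \<open>Differentiate E cnj(E) = 1 in t. The consequence used later is that
  \<open>Et p / E p\<close> is purely imaginary.\<close>

lemma unit_vector_derivative_orthogonal:
  assumes "p \<in> D"
  shows "Re (Et p * cnj (E p)) = 0"
proof -
  obtain t u where p: "p = (t, u)" by fastforce
  with assms have D: "(t, u) \<in> D" by simp
  obtain \<delta> where \<delta>: "\<delta> > 0" "(R \<inter> ball t \<delta>) \<times> ball u \<delta> \<subseteq> D"
    using rel_open_strip_box[OF D_open D] by metis
  have "t \<in> R" using D D_open openin_imp_subset by fastforce
  note * = partial_fst[OF D_open D E_deriv[OF D]]
  have "((\<lambda>\<tau>. E (\<tau>, u) * cnj (E (\<tau>, u))) has_vector_derivative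
      E (t, u) * cnj (Et (t, u)) + Et (t, u) * cnj (E (t, u))) (at t within R)"
    by (rule has_vector_derivative_mult[OF *
        bounded_linear.has_vector_derivative[OF bounded_linear_cnj *]])
  moreover have "((\<lambda>\<tau>. E (\<tau>, u) * cnj (E (\<tau>, u))) has_vector_derivative 0) (at t within R)"
  proof (rule has_vector_derivative_transform_within[OF has_vector_derivative_const \<delta>(1) \<open>t \<in> R\<close>])
    fix \<tau> assume "\<tau> \<in> R" "dist \<tau> t < \<delta>"
    then have "(\<tau>, u) \<in> D" using \<delta> by (auto simp: dist_commute)
    then show "1 = E (\<tau>, u) * cnj (E (\<tau>, u))" using norm_E by (simp flip: complex_norm_square)
  qed
  ultimately have "E (t, u) * cnj (Et (t, u)) + Et (t, u) * cnj (E (t, u)) = 0"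
    by (rule vector_derivative_unique_within[OF R_perfect[OF \<open>t \<in> R\<close>]])
  then have "Re (E (t, u) * cnj (Et (t, u)) + Et (t, u) * cnj (E (t, u))) = 0" by simp
  then show ?thesis unfolding p by (simp add: algebra_simps)
qed

end

section \<open>From local quadratics to one quadratic with positive coefficients\<close>

text \<open>Quadratics valid near neighbouring points agree on an overlap, so their coefficients
  coincide. The coefficient triple is thus locally constant on \<open>J\<close>, hence
  constant.\<close>

lemma locally_quadratic_imp_quadratic:
  fixes \<phi> :: "real \<Rightarrow> real"
  assumes J: "connected J"
    and loc: "\<And>a. a \<in> J \<Longrightarrow> \<exists>c d k. eventually (\<lambda>u. \<phi> u = c * u\<^sup>2 + d * u + k) (nhds a)"
  shows "\<exists>c d k. \<forall>a\<in>J. eventually (\<lambda>u. \<phi> u = c * u\<^sup>2 + d * u + k) (nhds a)"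
proof (cases "J = {}")
  case False
  then obtain b where b: "b \<in> J" by blast
  have "\<exists>Q. \<forall>a\<in>J. eventually (\<lambda>u. \<phi> u = fst (Q a) * u\<^sup>2 + fst (snd (Q a)) * u + snd (snd (Q a))) (nhds a)"
    by (rule bchoice) (use loc in fastforce)
  then obtain Q where Q: "\<And>a. a \<in> J \<Longrightarrow>
      eventually (\<lambda>u. \<phi> u = fst (Q a) * u\<^sup>2 + fst (snd (Q a)) * u + snd (snd (Q a))) (nhds a)"
    by blast
  have "eventually (\<lambda>a'. Q a = Q a') (at a within J)" if "a \<in> J" for a
  proof -
    \<comment> \<open>The quadratic chosen at a is also valid in a neighbourhood of every a' near a,
      where it can be compared with the one chosen at a'.\<close>
    have "eventually (\<lambda>a'. eventually (\<lambda>u. \<phi> u = fst (Q a) * u\<^sup>2 + fst (snd (Q a)) * u + snd (snd (Q a))) (nhds a')) (nhds a)"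
      using Q[OF that] by (simp add: eventually_eventually)
    then have "eventually (\<lambda>a'. a' \<in> J \<longrightarrow> Q a = Q a') (nhds a)"
    proof eventually_elim
      case (elim a')
      show ?case
      proof
        assume "a' \<in> J"
        from eventually_conj[OF elim Q[OF this]]
        have "eventually (\<lambda>u. fst (Q a) * u\<^sup>2 + fst (snd (Q a)) * u + snd (snd (Q a)) =
            fst (Q a') * u\<^sup>2 + fst (snd (Q a')) * u + snd (snd (Q a'))) (nhds a')"
          by eventually_elim simp
        from quadratic_coeffs_unique[OF this] show "Q a = Q a'"
          by (simp add: prod_eq_iff)
      qed
    qed
    then show ?thesis by (auto simp: eventually_at_filter elim: eventually_mono)
  qed
  then have "Q b = Q a" if "a \<in> J" for a
    using connected_local_const[OF J b that] by blast
  with Q show ?thesis by metis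
qed auto

lemma quadratic_coeffs_pos:
  fixes f :: "real \<Rightarrow> real"
  assumes pos: "eventually (\<lambda>u. f u > 0) (nhds a)"
    and q: "eventually (\<lambda>u. (f u)\<^sup>2 = c * u\<^sup>2 + d * u + k) (nhds a)"
    and "c \<ge> 0" "k \<ge> 0" "d\<^sup>2 \<le> 4 * c * k"
    and f': "deriv f a \<noteq> 0" and f'': "deriv (deriv f) a \<noteq> 0"
  shows "c > 0" and "k > 0"
proof -
  have fsqrt: "eventually (\<lambda>u. f u = sqrt (c * u\<^sup>2 + d * u + k)) (nhds a)"
    using pos q by eventually_elim (metis less_eq_real_def real_sqrt_unique)
  have "c \<noteq> 0"
  proof
    assume "c = 0"
    with assms(5) have "d = 0" by simp
    then have "eventually (\<lambda>u. f u = sqrt k) (nhds a)" using fsqrt \<open>c = 0\<close> by simp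
    then have "deriv f a = deriv (\<lambda>_. sqrt k) a" by (intro deriv_cong_ev) auto
    with f' show False by simp
  qed
  then show "c > 0" using assms(3) by simp
  have "k \<noteq> 0"
  proof
    assume "k = 0"
    with assms(5) have "d = 0" by simp
    then have f: "eventually (\<lambda>u. f u = sqrt c * \<bar>u\<bar>) (nhds a)"
      using fsqrt \<open>k = 0\<close> by (simp add: real_sqrt_mult)
    have "f a > 0" "f a = sqrt c * \<bar>a\<bar>"
      using eventually_nhds_x_imp_x[OF pos] eventually_nhds_x_imp_x[OF f] by auto
    \<comment> \<open>With k = d = 0 positivity of \<open>f\<close> at a keeps a away from the
      corner of |u|, so near a the absolute value is linear with slope \<open>sgn a\<close>.\<close>
    then have "a \<noteq> 0" by auto
    have "eventually (\<lambda>u. u \<in> (if a > 0 then {0<..} else {..<0})) (nhds a)"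
      using \<open>a \<noteq> 0\<close> by (intro eventually_nhds_in_open) auto
    with f have "eventually (\<lambda>u. f u = (sqrt c * sgn a) * u) (nhds a)"
      by eventually_elim (use \<open>a \<noteq> 0\<close> in \<open>auto split: if_splits simp: sgn_if\<close>)
    \<comment> \<open>The linear formula must hold near all b close to a, so that
      \<open>deriv f\<close> is known on a neighbourhood and can be differentiated again.\<close>
    then have "eventually (\<lambda>b. eventually (\<lambda>u. f u = (sqrt c * sgn a) * u) (nhds b)) (nhds a)"
      by (simp add: eventually_eventually)
    then have "eventually (\<lambda>b. deriv f b = sqrt c * sgn a) (nhds a)"
    proof eventually_elim
      case (elim b)
      then have "deriv f b = deriv (\<lambda>u. (sqrt c * sgn a) * u) b" by (intro deriv_cong_ev) auto
      then show ?case by simp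
    qed
    then have "deriv (deriv f) a = deriv (\<lambda>_. sqrt c * sgn a) a" by (intro deriv_cong_ev) auto
    with f'' show False by simp
  qed
  then show "k > 0" using assms(4) by simp
qed

section \<open>The explicit formula on a connected domain\<close>

text \<open>This passes the whole structure to a component of the coordinate domain, where the
  explicit formula is derived.\<close>

lemma ruled_map_subset:
  assumes "ruled_map R D f Z Z' E'" and V: "openin (top_of_set (R \<times> UNIV)) V" "V \<subseteq> D"
  shows "ruled_map R V f Z Z' E'"
proof -
  interpret ruled_map R D f Z Z' E' by fact
  show ?thesis
  proof
    show "convex R" by (rule convex_R)
    show "at t within R \<noteq> bot" if "t \<in> R" for t using R_perfect that by blast
    show "openin (top_of_set (R \<times> UNIV)) V" by fact
    show "(Z has_derivative Z' p) (at p within V)" if "p \<in> V" for p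
      using Z_deriv V(2) that has_derivative_subset by blast
    show "((\<lambda>p. Z' p (0, 1)) has_derivative E' p) (at p within V)" if "p \<in> V" for p
      using E_deriv V(2) that has_derivative_subset by blast
    show "continuous_on V (\<lambda>p. Z' p (1, 0))" "continuous_on V (\<lambda>p. E' p (1, 0))"
      using Zt_cont Et_cont V(2) continuous_on_subset by blast+
    show "cmod (Z' p (0, 1)) = 1" "cmod (Z' p (1, 0)) = f (snd p)" if "p \<in> V" for p
      using norm_E norm_Zt V(2) that by blast+
    show "collinear (Z ` ({t} \<times> K))" if "is_interval K" "{t} \<times> K \<subseteq> V" for t K
      using lines[OF that(1)] that(2) V(2) by blast
  qed
qed

context ruled_map
begin

text \<open>Uniqueness of the coefficients turns the given quadratic into pointwise information: the
  lengths of E' and P' and their inner product are the same at all points of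
  \<open>D\<close>.\<close>

lemma local_coeffs:
  assumes q: "\<forall>(t, u)\<in>D. (f u)\<^sup>2 = c * u\<^sup>2 + d * u + k" and "p \<in> D"
  shows "(cmod (Et p))\<^sup>2 = c" and "2 * Re (Pt p * cnj (Et p)) = d" and "(cmod (Pt p))\<^sup>2 = k"
proof -
  obtain t u where p: "p = (t, u)" by fastforce
  with \<open>p \<in> D\<close> have D: "(t, u) \<in> D" by simp
  have "eventually (\<lambda>\<upsilon>. (cmod (Et (t, u)))\<^sup>2 * \<upsilon>\<^sup>2 +
      2 * Re (Pt (t, u) * cnj (Et (t, u))) * \<upsilon> + (cmod (Pt (t, u)))\<^sup>2 =
      c * \<upsilon>\<^sup>2 + d * \<upsilon> + k) (nhds u)"
    using local_quadratic[OF D] local_form(2)[OF D]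
  proof eventually_elim
    case (elim \<upsilon>)
    moreover from elim have "(f \<upsilon>)\<^sup>2 = c * \<upsilon>\<^sup>2 + d * \<upsilon> + k" using q by blast
    ultimately show ?case by simp
  qed
  from quadratic_coeffs_unique[OF this] p
  show "(cmod (Et p))\<^sup>2 = c" "2 * Re (Pt p * cnj (Et p)) = d" "(cmod (Pt p))\<^sup>2 = k"
    by auto
qed

text \<open>The middle term is an antiderivative in t of P' = w0 E, where w0 has modulus sqrt k and
  argument \<open>\<theta>\<^sub>0\<close>. Integrating an exponential of frequency \<omega> =
  \<epsilon> sqrt c divides by i \<omega>, which accounts for - \<open>\<i>\<close> and, as
  \<epsilon>^2 = 1, for the factor \<epsilon> sqrt k / sqrt c.\<close>

lemma global_form:
  assumes D: "connected D" "D \<noteq> {}" and "c > 0" and "k > 0"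
    and q: "\<forall>(t, u)\<in>D. (f u)\<^sup>2 = c * u\<^sup>2 + d * u + k"
  obtains \<theta>\<^sub>0 c\<^sub>0 :: real and C :: complex and \<epsilon> :: real where "\<epsilon> \<in> {1, -1}"
    and "\<And>t u. (t, u) \<in> D \<Longrightarrow> Z (t, u) = of_real u * cis (\<epsilon> * sqrt c * t - c\<^sub>0) +
      of_real (\<epsilon> * sqrt k / sqrt c) * (- \<i> * cis (\<theta>\<^sub>0 + (\<epsilon> * sqrt c * t - c\<^sub>0))) + C"
proof -
  note coeffs = local_coeffs[OF q]
  have E0: "E p \<noteq> 0" if "p \<in> D" for p using norm_E[OF that] by auto
  have E_cont: "continuous_on D (\<lambda>p. E p)"
    using E_deriv by (meson has_derivative_continuous_on)
  have Pt_cont: "continuous_on D Pt"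
    unfolding Pt_def by (intro continuous_intros Zt_cont Et_cont)
  define r where "r p = Et p / E p" for p
  have "r p \<in> {\<i> * sqrt c, - \<i> * sqrt c}" if "p \<in> D" for p
  proof -
    have "Re (r p) = 0"
      using unit_vector_derivative_orthogonal[OF that] norm_E[OF that]
      by (simp add: r_def complex_div_cnj[of "Et p"])
    moreover have "(cmod (r p))\<^sup>2 = c"
      using coeffs(1)[OF that] norm_E[OF that] by (simp add: r_def norm_divide)
    ultimately have "(Im (r p))\<^sup>2 = (sqrt c)\<^sup>2"
      using \<open>c > 0\<close> by (simp add: cmod_power2)
    then have "Im (r p) = sqrt c \<or> Im (r p) = - sqrt c" by (rule power2_eq_iff[THEN iffD1])
    then show ?thesis using \<open>Re (r p) = 0\<close> by (auto simp: complex_eq_iff)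
  qed
  moreover have "continuous_on D r"
    unfolding r_def using E0 by (intro continuous_intros Et_cont E_cont) auto
  moreover from calculation(1) have "finite (r ` D)"
    by (meson finite.emptyI finite.insertI finite_subset image_subsetI)
  ultimately have "r constant_on D" and r_range: "\<forall>p\<in>D. r p \<in> {\<i> * sqrt c, - \<i> * sqrt c}"
    using continuous_finite_range_constant[OF D(1)] by auto
  then obtain \<epsilon> :: real where \<epsilon>: "\<epsilon> \<in> {1, -1}" "\<And>p. p \<in> D \<Longrightarrow> r p = \<i> * of_real (\<epsilon> * sqrt c)"
  proof -
    obtain z where z: "\<And>p. p \<in> D \<Longrightarrow> r p = z" using \<open>r constant_on D\<close> by (auto simp: constant_on_def)
    with r_range D(2) have "z \<in> {\<i> * sqrt c, - \<i> * sqrt c}" by fast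
    then consider "z = \<i> * of_real (1 * sqrt c)" | "z = \<i> * of_real (-1 * sqrt c)" by auto
    then show thesis using that[of 1] that[of "-1"] z by cases auto
  qed
  define \<omega> where "\<omega> = \<epsilon> * sqrt c"
  have \<omega>: "\<omega> \<noteq> 0" "\<omega>\<^sup>2 = c" "1 / \<omega> = \<epsilon> / sqrt c" using \<epsilon>(1) \<open>c > 0\<close> by (auto simp: \<omega>_def)
  have Et: "Et p = \<i> * of_real \<omega> * E p" if "p \<in> D" for p
    using \<epsilon>(2)[OF that] E0[OF that] unfolding r_def \<omega>_def by (simp add: divide_eq_eq)
  \<comment> \<open>In the moving frame \<open>E\<close> the inner product of P' and E' is \<omega>
    Im w, which fixes the imaginary part. The modulus of P' then fixes the real part up to
    sign.\<close>
  define w where "w p = Pt p / E p" for p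
  have "w p \<in> {Complex (sqrt (k - (d / (2 * \<omega>))\<^sup>2)) (d / (2 * \<omega>)),
               Complex (- sqrt (k - (d / (2 * \<omega>))\<^sup>2)) (d / (2 * \<omega>))}" if "p \<in> D" for p
  proof -
    have Pt: "Pt p = w p * E p" using E0[OF that] by (simp add: w_def)
    have "Pt p * cnj (Et p) = w p * cnj (\<i> * of_real \<omega>) * (E p * cnj (E p))"
      by (simp add: Et[OF that] Pt)
    also have "E p * cnj (E p) = 1" using norm_E[OF that] by (simp flip: complex_norm_square)
    finally have "d = 2 * (\<omega> * Im (w p))"
      using coeffs(2)[OF that] by (simp add: mult.commute)
    then have im: "Im (w p) = d / (2 * \<omega>)" using \<omega>(1) by (simp add: field_simps)
    have "(cmod (w p))\<^sup>2 = k"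
      using coeffs(3)[OF that] norm_E[OF that] by (simp add: w_def norm_divide)
    then have re: "(Re (w p))\<^sup>2 = k - (d / (2 * \<omega>))\<^sup>2"
      by (simp add: cmod_power2 im)
    have "\<bar>Re (w p)\<bar> = sqrt (k - (d / (2 * \<omega>))\<^sup>2)"
      unfolding re[symmetric] by simp
    then show ?thesis using im by (auto simp: complex_eq_iff abs_if split: if_splits)
  qed
  then have "finite (w ` D)"
    by (meson finite.emptyI finite.insertI finite_subset image_subsetI)
  moreover have "continuous_on D w"
    unfolding w_def using E0 by (intro continuous_intros Pt_cont E_cont) auto
  ultimately obtain w0 where w0: "\<And>p. p \<in> D \<Longrightarrow> w p = w0"
    using continuous_finite_range_constant[OF D(1), of w] by (auto simp: constant_on_def)
  have Pt: "Pt p = w0 * E p" if "p \<in> D" for p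
    using w0[OF that] E0[OF that] unfolding w_def by (simp add: divide_eq_eq)
  obtain p0 where p0: "p0 \<in> D" using D(2) by blast
  have "(cmod w0)\<^sup>2 = k"
    using coeffs(3)[OF p0] norm_E[OF p0] by (simp add: Pt[OF p0] norm_mult)
  then have "cmod w0 = sqrt k" by (metis norm_ge_zero real_sqrt_unique)
  then obtain \<theta>\<^sub>0 where \<theta>\<^sub>0: "w0 = of_real (sqrt k) * cis \<theta>\<^sub>0"
    by (metis rcis_cmod_Arg rcis_def)
  \<comment> \<open>Since E_u = 0, the full derivative of \<open>E\<close> is determined by
    \<open>Et\<close> alone.\<close>
  have E'_lin: "E' p v = of_real (fst v) * Et p" if "p \<in> D" for p v
  proof -
    have "E' p v = E' p (fst v *\<^sub>R (1, 0) + snd v *\<^sub>R (0, 1))" by simp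
    also have "\<dots> = fst v *\<^sub>R Et p + snd v *\<^sub>R E' p (0, 1)"
      using has_derivative_linear[OF E_deriv[OF that]] by (simp only: linear_add linear_scale)
    also have "E' p (0, 1) = 0" using local_form(1)[of "fst p" "snd p"] that by simp
    finally show ?thesis by (simp add: scaleR_conv_of_real)
  qed
  have Z'_lin: "Z' p v = of_real (fst v) * Zt p + of_real (snd v) * E p" if "p \<in> D" for p v
  proof -
    have "Z' p v = Z' p (fst v *\<^sub>R (1, 0) + snd v *\<^sub>R (0, 1))" by simp
    also have "\<dots> = fst v *\<^sub>R Zt p + snd v *\<^sub>R E p"
      using has_derivative_linear[OF Z_deriv[OF that]] by (simp only: linear_add linear_scale)
    finally show ?thesis by (simp add: scaleR_conv_of_real)
  qed
  have cis_deriv: "((\<lambda>p. cis (a + b * fst p)) has_derivative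
      (\<lambda>v. \<i> * of_real (b * fst v) * cis (a + b * fst p))) (at p within D)" for a b and p :: "real \<times> real"
    by (rule has_derivative_eq_rhs[OF has_derivative_cis[of "\<lambda>p. a + b * fst p" "\<lambda>v. b * fst v"]])
       (auto intro!: derivative_eq_intros simp: scaleR_conv_of_real fun_eq_iff)
  \<comment> \<open>Integrating factor for E' = i \<omega> E. The summand 0 only gives the argument
    of \<open>cis\<close> the shape required by \<open>cis_deriv\<close>.\<close>
  have const1: "E p * cis (0 + (- \<omega>) * fst p) = E p0 * cis (0 + (- \<omega>) * fst p0)" if "p \<in> D" for p
  proof (rule zero_derivative_constant[OF D_open convex_R _ D(1) order_refl that p0])
    fix p assume p: "p \<in> D"
    have "((\<lambda>p. E p * cis (0 + (- \<omega>) * fst p)) has_derivative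
       (\<lambda>v. E p * (\<i> * of_real ((- \<omega>) * fst v) * cis (0 + (- \<omega>) * fst p)) +
            E' p v * cis (0 + (- \<omega>) * fst p))) (at p within D)"
      by (rule has_derivative_mult[OF E_deriv[OF p] cis_deriv])
    moreover have "E p * (\<i> * of_real ((- \<omega>) * fst v) * cis (0 + (- \<omega>) * fst p)) +
            E' p v * cis (0 + (- \<omega>) * fst p) = 0" for v
      unfolding E'_lin[OF p, of v] Et[OF p] by (simp add: algebra_simps)
    ultimately show "((\<lambda>p. E p * cis (0 + (- \<omega>) * fst p)) has_derivative (\<lambda>_. 0)) (at p within D)"
      by simp
  qed
  have "cmod (E p0 * cis (0 + (- \<omega>) * fst p0)) = 1" using norm_E[OF p0] by (simp add: norm_mult)
  then obtain a where a: "E p0 * cis (0 + (- \<omega>) * fst p0) = cis a"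
    by (metis mult_1 of_real_1 rcis_cmod_Arg rcis_def)
  \<comment> \<open>The sign is chosen so that E = cis(-b(t)) with b(t) = -\<omega> t +
    \<open>c\<^sub>0\<close>.\<close>
  define c\<^sub>0 where "c\<^sub>0 = - a"
  have E: "E p = cis (- c\<^sub>0 + \<omega> * fst p)" if "p \<in> D" for p
  proof -
    have "E p = (E p * cis (0 + (- \<omega>) * fst p)) * cis (\<omega> * fst p)"
      by (simp add: mult.assoc cis_mult)
    also have "\<dots> = cis (- c\<^sub>0 + \<omega> * fst p)"
      unfolding const1[OF that] a by (simp add: c\<^sub>0_def cis_mult)
    finally show ?thesis .
  qed
  define G where "G p = of_real (sqrt k / \<omega>) * (- \<i> * cis ((\<theta>\<^sub>0 - c\<^sub>0) + \<omega> * fst p))" for p :: "real \<times> real"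
  have const2: "Z p - of_real (snd p) * E p - G p = Z p0 - of_real (snd p0) * E p0 - G p0"
    if "p \<in> D" for p
  proof (rule zero_derivative_constant[OF D_open convex_R _ D(1) order_refl that p0])
    fix p assume p: "p \<in> D"
    have "((\<lambda>p. Z p - of_real (snd p) * E p - G p) has_derivative
       (\<lambda>v. Z' p v - (of_real (snd p) * E' p v + of_real (snd v) * E p) -
          of_real (sqrt k / \<omega>) * (- \<i> * (\<i> * of_real (\<omega> * fst v) * cis ((\<theta>\<^sub>0 - c\<^sub>0) + \<omega> * fst p)))))
       (at p within D)"
      unfolding G_def
      by (intro has_derivative_diff has_derivative_mult has_derivative_mult_right Z_deriv[OF p]
          E_deriv[OF p] cis_deriv has_derivative_of_real has_derivative_snd has_derivative_ident)
    moreover have "Z' p v - (of_real (snd p) * E' p v + of_real (snd v) * E p) -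
          of_real (sqrt k / \<omega>) * (- \<i> * (\<i> * of_real (\<omega> * fst v) * cis ((\<theta>\<^sub>0 - c\<^sub>0) + \<omega> * fst p))) = 0"
      for v
    proof -
      have "cis ((\<theta>\<^sub>0 - c\<^sub>0) + \<omega> * fst p) = cis \<theta>\<^sub>0 * E p"
        by (simp add: E[OF p] cis_mult algebra_simps)
      moreover have "Zt p = of_real (sqrt k) * cis \<theta>\<^sub>0 * E p + of_real (snd p) * Et p"
        using Pt[OF p] \<theta>\<^sub>0 by (simp add: Pt_def algebra_simps)
      ultimately show ?thesis
        using \<omega>(1) unfolding E'_lin[OF p, of v] Z'_lin[OF p, of v] by (simp add: algebra_simps)
    qed
    ultimately show "((\<lambda>p. Z p - of_real (snd p) * E p - G p) has_derivative (\<lambda>_. 0)) (at p within D)"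
      by simp
  qed
  show thesis
  proof (rule that[OF \<epsilon>(1)])
    fix t u assume tu: "(t, u) \<in> D"
    have "sqrt k / \<omega> = \<epsilon> * sqrt k / sqrt c" using \<omega>(3) by (metis mult.commute times_divide_eq_right mult_1_right)
    with const2[OF tu] show "Z (t, u) = of_real u * cis (\<epsilon> * sqrt c * t - c\<^sub>0) +
      of_real (\<epsilon> * sqrt k / sqrt c) * (- \<i> * cis (\<theta>\<^sub>0 + (\<epsilon> * sqrt c * t - c\<^sub>0))) +
      (Z p0 - of_real (snd p0) * E p0 - G p0)"
      unfolding E[OF tu] G_def[of "(t, u)"] by (simp add: algebra_simps flip: \<omega>_def)
  qed
qed

end

section \<open>Stability properties of the class C^n\<close>

lemma C_class_on_continuous: "C_class_on n D h \<Longrightarrow> continuous_on D h"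
  by (cases n) (auto intro: has_derivative_continuous_on)

lemma C_class_on_bounded_linear:
  assumes "bounded_linear L" and "C_class_on n D h"
  shows "C_class_on n D (\<lambda>p. L (h p))"
  using assms(2)
proof (induction n arbitrary: h)
  case 0
  then show ?case using bounded_linear.continuous_on[OF assms(1)] by auto
next
  case (Suc n)
  then obtain h' where h': "\<And>p. p \<in> D \<Longrightarrow> (h has_derivative h' p) (at p within D)"
    "\<And>v. C_class_on n D (\<lambda>p. h' p v)" by auto
  have "((\<lambda>p. L (h p)) has_derivative (\<lambda>v. L (h' p v))) (at p within D)" if "p \<in> D" for p
    by (rule bounded_linear.has_derivative[OF assms(1) h'(1)[OF that]])
  then show ?case using Suc.IH[OF h'(2)] by (auto intro!: exI[of _ "\<lambda>p v. L (h' p v)"])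
qed

text \<open>The family is closed under directional derivatives: in direction v, \<alpha> becomes i
  \<omega> v1 \<alpha> and \<beta> becomes i \<omega> v1 \<beta> + \<alpha> v2. Hence the induction
  runs over arbitrary \<alpha> and \<beta>.\<close>

lemma C_class_on_cis_affine:
  "C_class_on n D (\<lambda>p. cis (\<omega> * fst p) * (\<alpha> * of_real (snd p) + \<beta>))"
proof (induction n arbitrary: \<alpha> \<beta>)
  case 0
  show ?case unfolding cis_conv_exp by (auto intro!: continuous_intros)
next
  case (Suc n)
  let ?h' = "\<lambda>p v. cis (\<omega> * fst p) *
    ((\<i> * of_real (\<omega> * fst v) * \<alpha>) * of_real (snd p) + (\<i> * of_real (\<omega> * fst v) * \<beta> + \<alpha> * of_real (snd v)))"
  have "((\<lambda>p. cis (\<omega> * fst p) * (\<alpha> * of_real (snd p) + \<beta>)) has_derivative ?h' p) (at p within D)" for p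
  proof -
    have "((\<lambda>p. cis (\<omega> * fst p)) has_derivative (\<lambda>v. \<i> * of_real (\<omega> * fst v) * cis (\<omega> * fst p)))
        (at p within D)"
      by (rule has_derivative_eq_rhs[OF has_derivative_cis[of "\<lambda>p. \<omega> * fst p" "\<lambda>v. \<omega> * fst v"]])
         (auto intro!: derivative_eq_intros simp: scaleR_conv_of_real fun_eq_iff)
    moreover have "((\<lambda>p. \<alpha> * of_real (snd p) + \<beta>) has_derivative (\<lambda>v. \<alpha> * of_real (snd v))) (at p within D)"
      by (auto intro!: derivative_eq_intros)
    ultimately show ?thesis
      by (rule has_derivative_eq_rhs[OF has_derivative_mult]) (auto simp: fun_eq_iff algebra_simps)
  qed
  then show ?case using Suc.IH by (auto intro!: exI[of _ ?h'] simp del: fst_conv snd_conv)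
qed

section \<open>Geometry of the parametrization\<close>

lemma continuous_on_vector_3:
  fixes h1 h2 h3 :: "'a::topological_space \<Rightarrow> real"
  assumes "continuous_on S h1" "continuous_on S h2" "continuous_on S h3"
  shows "continuous_on S (\<lambda>x. vector [h1 x, h2 x, h3 x] :: real^3)"
proof -
  have "(vector [a, b, c] :: real^3) = a *\<^sub>R axis 1 1 + b *\<^sub>R axis 2 1 + c *\<^sub>R axis 3 1" for a b c
    by (simp add: vec_eq_iff forall_3 axis_def)
  then show ?thesis by (simp add: continuous_intros assms)
qed

lemma rev_param_nth [simp]:
  "rev_param f g t u $ 1 = f u * cos t" "rev_param f g t u $ 2 = f u * sin t"
  "rev_param f g t u $ 3 = g u"
  by (simp_all add: rev_param_def)

lemma rev_param_radius:
  assumes "f u > 0"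
  shows "sqrt ((rev_param f g t u $ 1)\<^sup>2 + (rev_param f g t u $ 2)\<^sup>2) = f u"
proof -
  have "(f u * cos t)\<^sup>2 + (f u * sin t)\<^sup>2 = (f u)\<^sup>2 * ((cos t)\<^sup>2 + (sin t)\<^sup>2)"
    by (simp only: power_mult_distrib distrib_left)
  then show ?thesis using assms by simp
qed

text \<open>The distance from the axis gives f(u) and so u. After division by f(u) > 0 the angles
  agree up to a multiple of 2 pi, and the half-open interval admits only the multiple 0.\<close>

lemma rev_param_inj_on:
  assumes "inj_on f I" and pos: "\<forall>u\<in>I. f u > 0"
  shows "inj_on (\<lambda>(t, u). rev_param f g t u) ({0..<2 * pi} \<times> I)"
proof (rule inj_onI, clarify)
  fix t u t' u'
  assume *: "t \<in> {0..<2 * pi}" "t' \<in> {0..<2 * pi}" "u \<in> I" "u' \<in> I"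
    and eq: "rev_param f g t u = rev_param f g t' u'"
  have "f u = f u'"
    using rev_param_radius[of f u g t] rev_param_radius[of f u' g t'] pos * eq by simp
  then have u: "u = u'" using assms(1) * by (auto dest: inj_onD)
  have "f u * cos t = f u' * cos t'" "f u * sin t = f u' * sin t'"
    using eq by (metis rev_param_nth(1), metis rev_param_nth(2))
  then have "cos t = cos t'" "sin t = sin t'" using u pos * by auto
  then obtain n :: int where n: "t = t' + 2 * pi * of_int n"
    using sin_cos_eq_iff[of t t'] by auto
  have "2 * pi * of_int n < 2 * pi * 1" "2 * pi * (-1) < 2 * pi * of_int n"
    using * unfolding n atLeastLessThan_iff by linarith+
  then have "of_int n < (1::real)" "(-1::real) < of_int n"
    by (simp_all only: mult_less_cancel_left_pos pi_gt_zero zero_less_mult_iff zero_less_numeral simp_thms)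
  then have "n = 0" by linarith
  with n u show "t = t' \<and> u = u'" by simp
qed

lemma derivative_nonzero_inj_on:
  fixes f :: "real \<Rightarrow> real"
  assumes "is_interval I" and diff: "\<And>u. u \<in> I \<Longrightarrow> f differentiable (at u)"
    and "\<forall>u\<in>I. deriv f u \<noteq> 0"
  shows "inj_on f I"
proof -
  have "f a \<noteq> f b" if ab: "a \<in> I" "b \<in> I" "a < b" for a b
  proof
    assume eq: "f a = f b"
    have sub: "{a..b} \<subseteq> I"
      using mem_is_interval_1_I[OF assms(1) ab(1,2)] by auto
    have "continuous_on {a..b} f"
      using diff sub
      by (intro continuous_at_imp_continuous_on ballI differentiable_imp_continuous_within) auto
    moreover have "f differentiable (at x)" if "a < x" "x < b" for x
      by (rule diff, rule subsetD[OF sub]) (use that in simp)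
    ultimately obtain x where x: "a < x" "x < b" "DERIV f x :> 0"
      using Rolle[OF ab(3) eq] by blast
    from x(3) have "deriv f x = 0" by (rule DERIV_imp_deriv)
    with x(1,2) have "\<exists>x\<in>I. deriv f x = 0" using sub by (intro bexI[of _ x]) auto
    then show False using assms(3) by auto
  qed
  then show ?thesis by (intro inj_onI) (metis linorder_less_linear)
qed

text \<open>The coordinate domain can fall apart along the cut, but the set of its u-values cannot.
  The distance from the axis is continuous on the connected \<open>U\<close>, so its values form an
  interval, and an injective continuous \<open>f\<close> is monotone between two u-values, so it
  carries intermediate u to intermediate distances.\<close>

lemma connected_meridian_range:
  fixes U :: "(real^3) set"
  assumes I: "is_interval I" and cont: "continuous_on I f" and inj: "inj_on f I"
    and pos: "\<forall>u\<in>I. f u > 0" and U: "U \<subseteq> rev_surface f g I" "connected U"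
  shows "connected (snd ` coords f g I U)"
proof -
  let ?\<rho> = "\<lambda>x::real^3. sqrt ((x $ 1)\<^sup>2 + (x $ 2)\<^sup>2)"
  have coords: "u \<in> snd ` coords f g I U \<longleftrightarrow> u \<in> I \<and> f u \<in> ?\<rho> ` U" for u
  proof safe
    fix t \<upsilon> assume "(t, \<upsilon>) \<in> coords f g I U"
    then have *: "\<upsilon> \<in> I" "rev_param f g t \<upsilon> \<in> U" by (auto simp: coords_def)
    then show "snd (t, \<upsilon>) \<in> I" by simp
    have "?\<rho> (rev_param f g t \<upsilon>) = f \<upsilon>" using pos *(1) by (intro rev_param_radius) blast
    then show "f (snd (t, \<upsilon>)) \<in> ?\<rho> ` U"
      using *(2) unfolding snd_conv by (intro image_eqI[of _ _ "rev_param f g t \<upsilon>"]) simp_all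
  next
    fix x assume u: "u \<in> I" "x \<in> U" "f u = ?\<rho> x"
    then obtain t \<upsilon> where x: "x = rev_param f g t \<upsilon>" "t \<in> {0..2 * pi}" "\<upsilon> \<in> I"
      using U(1) unfolding rev_surface_def by blast
    have "f u = f \<upsilon>"
      unfolding u(3) x(1) by (rule rev_param_radius) (use pos x(3) in blast)
    then have "\<upsilon> = u" using inj_onD[OF inj _ x(3) u(1)] by simp
    \<comment> \<open>\<open>rev_surface\<close> allows the angle 2 pi, \<open>coords\<close> does
      not; that meridian is the one at angle 0.\<close>
    define t' where "t' = (if t = 2 * pi then 0 else t)"
    have "t' \<in> {0..<2 * pi}" "x = rev_param f g t' u"
      using x \<open>\<upsilon> = u\<close> by (auto simp: t'_def rev_param_def)
    then have "(t', u) \<in> coords f g I U" using u by (auto simp: coords_def)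
    then show "u \<in> snd ` coords f g I U" by (rule image_eqI[rotated]) simp
  qed
  have "connected (?\<rho> ` U)"
    by (intro connected_continuous_image U(2) continuous_intros)
  then have int: "is_interval (?\<rho> ` U)" by (simp add: is_interval_connected_1)
  show ?thesis unfolding is_interval_connected_1[symmetric] is_interval_1
  proof (intro ballI allI impI, elim conjE)
    fix a b x assume ab: "a \<in> snd ` coords f g I U" "b \<in> snd ` coords f g I U" "a \<le> x" "x \<le> b"
    then have abI: "a \<in> I" "b \<in> I" "f a \<in> ?\<rho> ` U" "f b \<in> ?\<rho> ` U"
      by (simp_all only: coords)
    have sub: "{a..b} \<subseteq> I" using mem_is_interval_1_I[OF I abI(1,2)] by auto
    then have xI: "x \<in> I" using ab(3,4) by auto
    show "x \<in> snd ` coords f g I U"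
    proof (cases "x = a \<or> x = b")
      case False
      then have lt: "a < x" "x < b" using ab by auto
      have "(f a < f x \<and> f x < f b) \<or> (f b < f x \<and> f x < f a)"
        by (rule continuous_inj_imp_mono[OF lt continuous_on_subset[OF cont sub] inj_on_subset[OF inj sub]])
      then have "f x \<in> ?\<rho> ` U"
        using mem_is_interval_1_I[OF int abI(3,4)] mem_is_interval_1_I[OF int abI(4,3)]
        by (meson less_imp_le)
      with xI show ?thesis unfolding coords by simp
    qed (use ab in auto)
  qed
qed

lemma openin_coords:
  assumes I: "open I" and "continuous_on I f" "continuous_on I g"
    and U: "openin (top_of_set (rev_surface f g I)) U"
  shows "openin (top_of_set ({0..<2 * pi} \<times> UNIV)) (coords f g I U)"
proof -
  obtain T where T: "open T" "U = rev_surface f g I \<inter> T"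
    using U by (auto simp: openin_open)
  let ?r = "\<lambda>p. rev_param f g (fst p) (snd p)"
  have "continuous_on (UNIV \<times> I) ?r"
    unfolding rev_param_def
    by (intro continuous_on_vector_3 continuous_intros continuous_on_compose2[OF assms(2)]
        continuous_on_compose2[OF assms(3)]) auto
  then have "open ((UNIV \<times> I) \<inter> ?r -` T)"
    using T(1) I by (metis continuous_on_open_vimage open_Times open_UNIV Int_commute)
  moreover have "coords f g I U = ({0..<2 * pi} \<times> UNIV) \<inter> ((UNIV \<times> I) \<inter> ?r -` T)"
  proof -
    have "rev_param f g t u \<in> rev_surface f g I" if "t \<in> {0..<2 * pi}" "u \<in> I" for t u
      unfolding rev_surface_def using that by (intro CollectI exI[of _ t] exI[of _ u]) auto
    then show ?thesis by (auto simp: coords_def T(2))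
  qed
  ultimately show ?thesis by (auto simp: openin_open)
qed

lemma at_within_Ico_neq_bot: "(t::real) \<in> {a..<b} \<Longrightarrow> at t within {a..<b} \<noteq> bot"
  by (auto simp: trivial_limit_within intro!: connected_imp_perfect)

section \<open>From admissible maps to ruled maps\<close>

definition plane_to_complex :: "real^2 \<Rightarrow> complex" where
  "plane_to_complex v = Complex (v $ 1) (v $ 2)"

lemma bounded_linear_plane_to_complex: "bounded_linear plane_to_complex"
  unfolding linear_conv_bounded_linear[symmetric]
  by (intro linearI) (auto simp: plane_to_complex_def complex_eq_iff)

lemma bounded_linear_complex_to_plane: "bounded_linear (\<lambda>z. vector [Re z, Im z] :: real^2)"
  unfolding linear_conv_bounded_linear[symmetric]
  by (intro linearI) (auto simp: vec_eq_iff forall_2)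

lemma ruled_map_admissible:
  assumes "s \<ge> 2" and D: "openin (top_of_set ({0..<2 * pi} \<times> UNIV)) (coords f g I U)"
    and adm: "admissible_map s f g I U \<Phi>"
  obtains Z' E' where "ruled_map {0..<2 * pi} (coords f g I U) f
    (\<lambda>p. plane_to_complex (\<Phi> (rev_param f g (fst p) (snd p)))) Z' E'"
proof -
  let ?D = "coords f g I U" and ?R = "{0..<2 * pi}"
  define Z where "Z p = plane_to_complex (\<Phi> (rev_param f g (fst p) (snd p)))" for p
  \<comment> \<open>Two orders of smoothness are consumed: one gives \<open>Z'\<close>, the other
    differentiates \<open>Z'\<close> in the direction (0, 1) and gives \<open>E'\<close>.\<close>
  obtain m where m: "s = Suc (Suc m)" using \<open>s \<ge> 2\<close> by (metis add_2_eq_Suc le_Suc_ex)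
  have "C_class_on s ?D Z"
    unfolding Z_def using adm
    by (intro C_class_on_bounded_linear[OF bounded_linear_plane_to_complex])
       (simp add: admissible_map_def case_prod_unfold)
  then obtain Z' where Z': "\<And>p. p \<in> ?D \<Longrightarrow> (Z has_derivative Z' p) (at p within ?D)"
      "\<And>v. C_class_on (Suc m) ?D (\<lambda>p. Z' p v)"
    unfolding m by (auto simp del: C_class_on.simps(2) simp: C_class_on.simps(2)[of "Suc m"])
  from Z'(2)[of "(0, 1)"] obtain E' where
    E': "\<And>p. p \<in> ?D \<Longrightarrow> ((\<lambda>p. Z' p (0, 1)) has_derivative E' p) (at p within ?D)"
      "\<And>v. C_class_on m ?D (\<lambda>p. E' p v)"
    by auto
  have metric: "cmod (Z' p (0, 1)) = 1 \<and> cmod (Z' p (1, 0)) = f (snd p)" if "p \<in> ?D" for p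
  proof -
    obtain t u where p: "p = (t, u)" by fastforce
    have tu: "(t, u) \<in> ?D" using that p by simp
    then have "t \<in> ?R" by (auto simp: coords_def)
    note R = at_within_Ico_neq_bot[OF this]
    note du = partial_snd[OF D tu Z'(1)[OF tu]] and dt = partial_fst[OF D tu Z'(1)[OF tu]]
    note du12 = bounded_linear.has_vector_derivative[OF bounded_linear_Re du]
      bounded_linear.has_vector_derivative[OF bounded_linear_Im du]
    note dt12 = bounded_linear.has_vector_derivative[OF bounded_linear_Re dt]
      bounded_linear.has_vector_derivative[OF bounded_linear_Im dt]
    have u12: "deriv (\<lambda>\<upsilon>. \<Phi> (rev_param f g t \<upsilon>) $ 1) u = Re (Z' (t, u) (0, 1))"
      "deriv (\<lambda>\<upsilon>. \<Phi> (rev_param f g t \<upsilon>) $ 2) u = Im (Z' (t, u) (0, 1))"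
      using du12 by (auto intro!: DERIV_imp_deriv
          simp: Z_def plane_to_complex_def has_real_derivative_iff_has_vector_derivative)
    have t12: "vector_derivative (\<lambda>\<tau>. \<Phi> (rev_param f g \<tau> u) $ 1) (at t within ?R) = Re (Z' (t, u) (1, 0))"
      "vector_derivative (\<lambda>\<tau>. \<Phi> (rev_param f g \<tau> u) $ 2) (at t within ?R) = Im (Z' (t, u) (1, 0))"
      using dt12 by (auto intro!: vector_derivative_within[OF R] simp: Z_def plane_to_complex_def)
    have "preserves_metric_on_coordinate_curves f g I U \<Phi>"
      using adm by (simp add: admissible_map_def)
    with tu have "sqrt ((Re (Z' (t, u) (0, 1)))\<^sup>2 + (Im (Z' (t, u) (0, 1)))\<^sup>2) = 1"
      "sqrt ((Re (Z' (t, u) (1, 0)))\<^sup>2 + (Im (Z' (t, u) (1, 0)))\<^sup>2) = f u"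
      unfolding preserves_metric_on_coordinate_curves_def Let_def u12[symmetric] t12[symmetric]
      by blast+
    then show ?thesis by (simp add: p cmod_def)
  qed
  have "ruled_map ?R ?D f Z Z' E'"
  proof
    show "convex ?R" by (rule convex_real_interval)
    show "at t within ?R \<noteq> bot" if "t \<in> ?R" for t using at_within_Ico_neq_bot that by blast
    show "openin (top_of_set (?R \<times> UNIV)) ?D" by (rule D)
    show "(Z has_derivative Z' p) (at p within ?D)" if "p \<in> ?D" for p using Z'(1) that .
    show "((\<lambda>p. Z' p (0, 1)) has_derivative E' p) (at p within ?D)" if "p \<in> ?D" for p
      using E'(1) that .
    show "continuous_on ?D (\<lambda>p. Z' p (1, 0))" "continuous_on ?D (\<lambda>p. E' p (1, 0))"
      using C_class_on_continuous Z'(2) E'(2) by blast+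
    show "cmod (Z' p (0, 1)) = 1" "cmod (Z' p (1, 0)) = f (snd p)" if "p \<in> ?D" for p
      using metric[OF that] by auto
    show "collinear (Z ` ({t} \<times> K))" if K: "is_interval K" "{t} \<times> K \<subseteq> ?D" for t K
    \<comment> \<open>A point of \<open>K\<close> is what places t in the angle interval, so the
      empty set is treated apart.\<close>
    proof (cases "K = {}")
      case False
      with K have "t \<in> ?R" "K \<subseteq> I" "rev_param f g t ` K \<subseteq> U" by (auto simp: coords_def)
      with K(1) adm obtain L where L: "aff_dim L = 1" "\<Phi> ` rev_param f g t ` K \<subseteq> L"
        unfolding admissible_map_def meridians_to_lines_def by blast
      then have "collinear L" by (simp add: collinear_aff_dim)
      then obtain w where w: "\<And>x y. x \<in> L \<Longrightarrow> y \<in> L \<Longrightarrow> \<exists>c. x - y = c *\<^sub>R w"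
        unfolding collinear_def by metis
      show ?thesis unfolding collinear_def
      proof (intro exI[of _ "plane_to_complex w"] ballI)
        fix x y assume "x \<in> Z ` ({t} \<times> K)" "y \<in> Z ` ({t} \<times> K)"
        then obtain a b where ab: "x = plane_to_complex a" "y = plane_to_complex b" "a \<in> L" "b \<in> L"
          using L(2) by (force simp: Z_def)
        then obtain c where "a - b = c *\<^sub>R w" using w by blast
        then have "x - y = c *\<^sub>R plane_to_complex w"
          using bounded_linear.linear[OF bounded_linear_plane_to_complex] ab
          by (metis linear_diff linear_scale)
        then show "\<exists>c. x - y = c *\<^sub>R plane_to_complex w" by blast
      qed
    qed simp
  qed
  then show thesis using that unfolding Z_def by blast
qed

section \<open>Construction of an admissible map\<close>

lemma C_class_on_cong:
  assumes "\<And>p. p \<in> D \<Longrightarrow> h p = k p" and "C_class_on n D k"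
  shows "C_class_on n D h"
proof (cases n)
  case 0
  then show ?thesis using assms continuous_on_cong by (metis C_class_on.simps(1))
next
  case (Suc m)
  with assms(2) obtain k' where k': "\<And>p. p \<in> D \<Longrightarrow> (k has_derivative k' p) (at p within D)"
    "\<And>v. C_class_on m D (\<lambda>p. k' p v)" by auto
  have "(h has_derivative k' p) (at p within D)" if "p \<in> D" for p
    by (rule has_derivative_transform[OF that assms(1) k'(1)[OF that]])
  with k'(2) show ?thesis unfolding Suc by auto
qed

lemma complex_line_in_plane:
  fixes z w :: complex
  assumes "w \<noteq> 0"
  shows "\<exists>L::(real^2) set. affine L \<and> aff_dim L = 1 \<and>
    (\<forall>u::real. vector [Re (z + of_real u * w), Im (z + of_real u * w)] \<in> L)"
proof -
  let ?v = "\<lambda>z. vector [Re z, Im z] :: real^2"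
  let ?L = "affine hull {?v z, ?v (z + w)}"
  have "?v z \<noteq> ?v (z + w)" using assms by (auto simp: vec_eq_iff forall_2 complex_eq_iff)
  then have "aff_dim ?L = 1" by (simp add: aff_dim_affine_hull)
  moreover have "?v (z + of_real u * w) \<in> ?L" for u
  proof -
    have "?v (z + of_real u * w) = (1 - u) *\<^sub>R ?v z + u *\<^sub>R ?v (z + w)"
      by (simp add: vec_eq_iff forall_2 algebra_simps)
    then show ?thesis unfolding affine_hull_2
      by (intro CollectI exI[of _ "1 - u"] exI[of _ u]) simp
  qed
  ultimately show ?thesis by (intro exI[of _ ?L]) (simp add: affine_affine_hull)
qed

text \<open>The map is Z = cis(\<omega> t)(u + \<beta>): a fixed line rotated about the origin with
  angular speed \<omega>. The images of the meridians lie on lines at distance |Im \<beta>| from the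
  origin, tangent to a circle or, if Im \<beta> = 0, all through its centre.\<close>

lemma admissible_map_exists:
  assumes I: "open I" and inj: "inj_on f I" and pos: "\<forall>u\<in>I. f u > 0"
    and c: "c > 0" and cdk: "d\<^sup>2 \<le> 4 * c * k"
    and q: "\<forall>(t, u)\<in>coords f g I U. (f u)\<^sup>2 = c * u\<^sup>2 + d * u + k"
  shows "\<exists>\<Phi>. admissible_map s f g I U \<Phi>"
proof -
  let ?R = "{0..<2 * pi}" and ?D = "coords f g I U"
  define \<omega> where "\<omega> = sqrt c"
  \<comment> \<open>Here Z_t = cis(\<omega> t)(i \<omega> u + w) with w = i \<omega> \<beta>, of
    squared length c u^2 + 2 \<omega> Im(w) u + |w|^2. Matching the coefficients d and k forces this
    \<open>w\<close>, up to the sign of its real part.\<close>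
  define w where "w = Complex (sqrt (k - d\<^sup>2 / (4 * c))) (d / (2 * \<omega>))"
  define \<beta> where "\<beta> = w / (\<i> * of_real \<omega>)"
  define Z where "Z t u = cis (\<omega> * t) * (1 * of_real u + \<beta>)" for t u :: real
  define r where "r = (\<lambda>(t, u). rev_param f g t u)"
  \<comment> \<open>The angle is read off in [0, 2 pi). In general Z does not close up after a full
    turn; smoothness is demanded only in the cut coordinates.\<close>
  define \<Phi> :: "real^3 \<Rightarrow> real^2" where
    "\<Phi> x = (case inv_into (?R \<times> I) r x of (t, u) \<Rightarrow> vector [Re (Z t u), Im (Z t u)])" for x
  have \<Phi>: "\<Phi> (rev_param f g t u) = vector [Re (Z t u), Im (Z t u)]" if "t \<in> ?R" "u \<in> I" for t u
  proof -
    have "inj_on r (?R \<times> I)" unfolding r_def by (rule rev_param_inj_on[OF inj pos])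
    then have "inv_into (?R \<times> I) r (r (t, u)) = (t, u)" using that by (intro inv_into_f_f) auto
    then show ?thesis by (simp add: \<Phi>_def r_def)
  qed
  have \<omega>: "\<omega> > 0" "\<omega>\<^sup>2 = c" using c by (auto simp: \<omega>_def)
  have Zu: "((\<lambda>\<upsilon>. Z t \<upsilon>) has_vector_derivative cis (\<omega> * t)) (at u)" for t u
    unfolding Z_def by (auto intro!: derivative_eq_intros)
  have Zt: "((\<lambda>\<tau>. Z \<tau> u) has_vector_derivative cis (\<omega> * t) * (of_real (\<omega> * u) * \<i> + w)) (at t within ?R)" for t u
  proof -
    have "((\<lambda>\<tau>. cis (\<omega> * \<tau>)) has_vector_derivative \<omega> *\<^sub>R (\<i> * cis (\<omega> * t))) (at t within ?R)"
      unfolding has_vector_derivative_def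
      by (rule has_derivative_eq_rhs[OF has_derivative_cis[of "\<lambda>\<tau>. \<omega> * \<tau>" "\<lambda>v. \<omega> * v"]])
         (auto intro!: derivative_eq_intros simp: fun_eq_iff)
    from has_vector_derivative_mult_left[OF this, of "1 * of_real u + \<beta>"]
    have "((\<lambda>\<tau>. Z \<tau> u) has_vector_derivative
        \<omega> *\<^sub>R (\<i> * cis (\<omega> * t)) * (1 * of_real u + \<beta>)) (at t within ?R)"
      unfolding Z_def .
    moreover have "\<omega> *\<^sub>R (\<i> * cis (\<omega> * t)) * (1 * of_real u + \<beta>) =
        cis (\<omega> * t) * (of_real (\<omega> * u) * \<i> + w)"
      using \<omega>(1) by (simp add: \<beta>_def scaleR_conv_of_real field_simps)
    ultimately show ?thesis by simp
  qed
  have C: "C_class_on s ?D (\<lambda>(t, u). \<Phi> (rev_param f g t u))"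
  proof (rule C_class_on_cong)
    show "C_class_on s ?D (\<lambda>p. vector [Re (Z (fst p) (snd p)), Im (Z (fst p) (snd p))] :: real^2)"
      unfolding Z_def
      by (rule C_class_on_bounded_linear[OF bounded_linear_complex_to_plane C_class_on_cis_affine])
    show "(case p of (t, u) \<Rightarrow> \<Phi> (rev_param f g t u)) =
        vector [Re (Z (fst p) (snd p)), Im (Z (fst p) (snd p))]" if "p \<in> ?D" for p
      using that \<Phi> by (auto simp: coords_def)
  qed
  have L: "meridians_to_lines f g I U \<Phi>"
    unfolding meridians_to_lines_def
  proof (intro ballI allI impI, elim conjE)
    fix t K assume tK: "t \<in> ?R" "K \<subseteq> I"
    obtain L :: "(real^2) set" where L: "affine L" "aff_dim L = 1"
      "\<And>u::real. vector [Re (cis (\<omega> * t) * \<beta> + of_real u * cis (\<omega> * t)),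
                         Im (cis (\<omega> * t) * \<beta> + of_real u * cis (\<omega> * t))] \<in> L"
      using complex_line_in_plane[of "cis (\<omega> * t)" "cis (\<omega> * t) * \<beta>"] cis_neq_zero by blast
    have Z: "Z t u = cis (\<omega> * t) * \<beta> + of_real u * cis (\<omega> * t)" for u
      by (simp add: Z_def algebra_simps)
    have "\<Phi> (rev_param f g t u) \<in> L" if "u \<in> K" for u
      using \<Phi>[OF tK(1) subsetD[OF tK(2) that]] L(3)[of u] unfolding Z by simp
    then show "\<exists>L. affine L \<and> aff_dim L = 1 \<and> \<Phi> ` rev_param f g t ` K \<subseteq> L"
      using L(1,2) by blast
  qed
  have M: "preserves_metric_on_coordinate_curves f g I U \<Phi>"
    unfolding preserves_metric_on_coordinate_curves_def Let_def
  proof (intro ballI, clarify)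
    fix t u assume tu: "(t, u) \<in> ?D"
    then have t: "t \<in> ?R" and u: "u \<in> I" by (auto simp: coords_def)
    note du = bounded_linear.has_vector_derivative[OF bounded_linear_Re Zu[of t u]]
      bounded_linear.has_vector_derivative[OF bounded_linear_Im Zu[of t u]]
    note dt = bounded_linear.has_vector_derivative[OF bounded_linear_Re Zt[of u t]]
      bounded_linear.has_vector_derivative[OF bounded_linear_Im Zt[of u t]]
    \<comment> \<open>The formula for \<Phi> is known only for parameters in
      \<open>?R \<times> I\<close>, so u-derivatives are transferred on the open set
      \<open>I\<close> and t-derivatives within \<open>?R\<close>.\<close>
    have u12: "deriv (\<lambda>\<upsilon>. \<Phi> (rev_param f g t \<upsilon>) $ 1) u = Re (cis (\<omega> * t))"
      "deriv (\<lambda>\<upsilon>. \<Phi> (rev_param f g t \<upsilon>) $ 2) u = Im (cis (\<omega> * t))"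
      by (rule DERIV_imp_deriv,
          rule has_field_derivative_transform_within_open[OF _ I u],
          rule du[folded has_real_derivative_iff_has_vector_derivative],
          simp add: \<Phi>[OF t])+
    have t12: "vector_derivative (\<lambda>\<tau>. \<Phi> (rev_param f g \<tau> u) $ 1) (at t within ?R) =
        Re (cis (\<omega> * t) * (of_real (\<omega> * u) * \<i> + w))"
      "vector_derivative (\<lambda>\<tau>. \<Phi> (rev_param f g \<tau> u) $ 2) (at t within ?R) =
        Im (cis (\<omega> * t) * (of_real (\<omega> * u) * \<i> + w))"
      by (rule vector_derivative_within[OF at_within_Ico_neq_bot[OF t]],
          rule has_vector_derivative_transform[OF t _ dt(1)], simp add: \<Phi>[OF _ u],
          rule vector_derivative_within[OF at_within_Ico_neq_bot[OF t]],
          rule has_vector_derivative_transform[OF t _ dt(2)], simp add: \<Phi>[OF _ u])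
    \<comment> \<open>The radicand in \<open>w\<close> is nonnegative, so the square of the real
      part of \<open>w\<close> is really k - d^2 / (4c).\<close>
    have "d\<^sup>2 / (4 * c) \<le> k" using cdk c by (simp add: divide_le_eq mult.commute)
    then have "(cmod (of_real (\<omega> * u) * \<i> + w))\<^sup>2 = k - d\<^sup>2 / (4 * c) + (\<omega> * u + d / (2 * \<omega>))\<^sup>2"
      by (simp add: cmod_power2 w_def)
    also have "(\<omega> * u + d / (2 * \<omega>))\<^sup>2 = \<omega>\<^sup>2 * u\<^sup>2 + d * u + d\<^sup>2 / (4 * \<omega>\<^sup>2)"
      using \<omega>(1) by (simp add: power2_eq_square field_simps)
    also have "k - d\<^sup>2 / (4 * c) + \<dots> = (f u)\<^sup>2"
    proof -
      have "(f u)\<^sup>2 = c * u\<^sup>2 + d * u + k" using q tu by blast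
      then show ?thesis unfolding \<omega>(2) by simp
    qed
    finally have "(cmod (of_real (\<omega> * u) * \<i> + w))\<^sup>2 = (f u)\<^sup>2" .
    moreover have "f u \<ge> 0" using bspec[OF pos u] by (rule less_imp_le)
    ultimately have "cmod (of_real (\<omega> * u) * \<i> + w) = f u"
      by (rule power2_eq_imp_eq[OF _ norm_ge_zero])
    then have "cmod (cis (\<omega> * t) * (of_real (\<omega> * u) * \<i> + w)) = f u" by (simp add: norm_mult)
    moreover have "cmod (cis (\<omega> * t)) = 1" by simp
    ultimately show "sqrt ((deriv (\<lambda>\<upsilon>. \<Phi> (rev_param f g t \<upsilon>) $ 1) u)\<^sup>2 +
          (deriv (\<lambda>\<upsilon>. \<Phi> (rev_param f g t \<upsilon>) $ 2) u)\<^sup>2) = 1 \<and>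
        sqrt ((vector_derivative (\<lambda>\<tau>. \<Phi> (rev_param f g \<tau> u) $ 1) (at t within ?R))\<^sup>2 +
          (vector_derivative (\<lambda>\<tau>. \<Phi> (rev_param f g \<tau> u) $ 2) (at t within ?R))\<^sup>2) = f u"
      unfolding u12 t12 cmod_def by (intro conjI)
  qed
  from C L M show ?thesis unfolding admissible_map_def by blast
qed

section \<open>Necessity of the quadratic, and the theorem\<close>

lemma (in ruled_map) global_quadratic:
  assumes conn: "connected (snd ` D)" and "D \<noteq> {}"
    and I: "open I" "snd ` D \<subseteq> I" "\<forall>u\<in>I. f u > 0" "\<forall>u\<in>I. deriv f u \<noteq> 0"
      "\<forall>u\<in>I. deriv (deriv f) u \<noteq> 0"
  shows "\<exists>c d k. k > 0 \<and> c > 0 \<and> d\<^sup>2 \<le> 4 * c * k \<and>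
    (\<forall>(t, u)\<in>D. (f u)\<^sup>2 = c * u\<^sup>2 + d * u + k)"
proof -
  have "\<exists>c d k. eventually (\<lambda>u. (f u)\<^sup>2 = c * u\<^sup>2 + d * u + k) (nhds a)" if "a \<in> snd ` D" for a
    using that local_quadratic by fastforce
  from locally_quadratic_imp_quadratic[OF conn this] obtain c d k
    where cdk: "\<And>a. a \<in> snd ` D \<Longrightarrow> eventually (\<lambda>u. (f u)\<^sup>2 = c * u\<^sup>2 + d * u + k) (nhds a)"
    by blast
  obtain t u where tu: "(t, u) \<in> D" using \<open>D \<noteq> {}\<close> by auto
  then have uD: "u \<in> snd ` D" by force
  then have u: "u \<in> I" using I(2) by blast
  from eventually_conj[OF local_quadratic[OF tu] cdk[OF uD]]
  have "eventually (\<lambda>\<upsilon>. c * \<upsilon>\<^sup>2 + d * \<upsilon> + k = (cmod (Et (t, u)))\<^sup>2 * \<upsilon>\<^sup>2 +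
      2 * Re (Pt (t, u) * cnj (Et (t, u))) * \<upsilon> + (cmod (Pt (t, u)))\<^sup>2) (nhds u)"
    by eventually_elim simp
  note eqs = quadratic_coeffs_unique[OF this]
  \<comment> \<open>At a single point Re z = d / 2 and |z|^2 = ck, so the bound on d is the
    inequality between real part and modulus. The same point exhibits c and k as squares of moduli,
    hence nonnegative.\<close>
  define z where "z = Pt (t, u) * cnj (Et (t, u))"
  have "(Re z)\<^sup>2 \<le> (cmod z)\<^sup>2"
    by (simp add: cmod_power2)
  moreover have "(cmod z)\<^sup>2 = c * k"
    by (simp add: z_def eqs norm_mult power_mult_distrib)
  moreover have "d = 2 * Re z" unfolding eqs z_def ..
  ultimately have d: "d\<^sup>2 \<le> 4 * c * k" by (simp add: power_mult_distrib)
  have "eventually (\<lambda>u. f u > 0) (nhds u)"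
    using eventually_nhds_in_open[OF I(1) u] by eventually_elim (use I(3) in blast)
  from quadratic_coeffs_pos[OF this cdk[OF uD] _ _ d] I(4,5) u
  have "c > 0" "k > 0" by (simp_all add: eqs)
  moreover have "\<forall>(t, u)\<in>D. (f u)\<^sup>2 = c * u\<^sup>2 + d * u + k"
  proof clarify
    fix t u assume "(t, u) \<in> D"
    then have "u \<in> snd ` D" by force
    from eventually_nhds_x_imp_x[OF cdk[OF this]] show "(f u)\<^sup>2 = c * u\<^sup>2 + d * u + k" .
  qed
  ultimately show ?thesis using d by blast
qed

text \<open>The sign \<epsilon> reflects the freedom of orientation: a reflection of the plane
  preserves admissibility and replaces b by -b. It is quantified inside each component because the
  pieces created by the cut can be reflected independently.\<close>

theorem theorem1:
  fixes f g :: "real \<Rightarrow> real" and I :: "real set" and U :: "(real^3) set" and s :: nat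
  assumes "s \<ge> 2"
    and "open I" and "is_interval I"
    and "C_class_on s I f" and "C_class_on s I g"
    and "\<forall>u\<in>I. f u > 0"
    and "\<forall>u\<in>I. (deriv f u)\<^sup>2 + (deriv g u)\<^sup>2 = 1"
    and "\<forall>u\<in>I. deriv f u \<noteq> 0"
    and "\<forall>u\<in>I. deriv (deriv f) u \<noteq> 0"
    and "openin (top_of_set (rev_surface f g I)) U" and "connected U"
  shows "((\<exists>\<Phi>. admissible_map s f g I U \<Phi>) \<longleftrightarrow>
          (\<exists>c d k. k > 0 \<and> c > 0 \<and> d\<^sup>2 \<le> 4 * c * k \<and>
             (\<forall>(t, u)\<in>coords f g I U. (f u)\<^sup>2 = c * u\<^sup>2 + d * u + k))) \<and>
         (\<forall>\<Phi> c d k.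
            admissible_map s f g I U \<Phi> \<and> k > 0 \<and> c > 0 \<and>
            (\<forall>(t, u)\<in>coords f g I U. (f u)\<^sup>2 = c * u\<^sup>2 + d * u + k) \<longrightarrow>
            (\<forall>V\<in>components (coords f g I U).
               \<exists>\<theta>\<^sub>0 c\<^sub>0 A B b. \<exists>\<epsilon>\<in>{1, -1}.
                 b = (\<lambda>t. - \<epsilon> * sqrt c * t + c\<^sub>0) \<and>
                 (\<forall>t. (A has_real_derivative sqrt k * cos (\<theta>\<^sub>0 - b t)) (at t)) \<and>
                 (\<forall>t. (B has_real_derivative sqrt k * sin (\<theta>\<^sub>0 - b t)) (at t)) \<and>
                 (\<forall>(t, u)\<in>V.
                    \<Phi> (rev_param f g t u) $ 1 = u * cos (b t) + A t \<and>
                    \<Phi> (rev_param f g t u) $ 2 = - u * sin (b t) + B t)))"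
proof -
  let ?D = "coords f g I U" and ?R = "{0..<2 * pi}"
  have fI: "continuous_on I f" and gI: "continuous_on I g"
    using assms(4,5) C_class_on_continuous by blast+
  have diff: "f differentiable (at u)" if "u \<in> I" for u
  proof -
    obtain m where "s = Suc m" using assms(1) by (cases s) auto
    with assms(4) that obtain f' where "(f has_derivative f' u) (at u within I)" by auto
    then show ?thesis using at_within_open[OF that assms(2)] by (auto simp: differentiable_def)
  qed
  have inj: "inj_on f I"
    by (rule derivative_nonzero_inj_on[OF assms(3) diff assms(8)])
  have D: "openin (top_of_set (?R \<times> UNIV)) ?D"
    by (rule openin_coords[OF assms(2) fI gI assms(10)])
  have conn: "connected (snd ` ?D)"
    by (rule connected_meridian_range[OF assms(3) fI inj assms(6) openin_imp_subset[OF assms(10)] assms(11)])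
  have only_if: "\<exists>c d k. k > 0 \<and> c > 0 \<and> d\<^sup>2 \<le> 4 * c * k \<and>
      (\<forall>(t, u)\<in>?D. (f u)\<^sup>2 = c * u\<^sup>2 + d * u + k)" if adm: "admissible_map s f g I U \<Phi>" for \<Phi>
  proof (cases "?D = {}")
    case True
    \<comment> \<open>Without coordinate points the condition on f is vacuous, so any constants
      obeying the inequalities serve.\<close>
    then show ?thesis by (intro exI[of _ 1] exI[of _ 0] exI[of _ 1]) auto
  next
    case False
    obtain Z' E' where "ruled_map ?R ?D f
        (\<lambda>p. plane_to_complex (\<Phi> (rev_param f g (fst p) (snd p)))) Z' E'"
      using ruled_map_admissible[OF assms(1) D adm] by blast
    moreover have "snd ` ?D \<subseteq> I" by (auto simp: coords_def)
    ultimately show ?thesis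
      using ruled_map.global_quadratic[OF _ conn False assms(2) _ assms(6,8,9)] by blast
  qed
  have if_part: "\<exists>\<Phi>. admissible_map s f g I U \<Phi>"
    if "c > 0" "d\<^sup>2 \<le> 4 * c * k" "\<forall>(t, u)\<in>?D. (f u)\<^sup>2 = c * u\<^sup>2 + d * u + k" for c d k
    by (rule admissible_map_exists[OF assms(2) inj assms(6) that])
  have form: "\<exists>\<theta>\<^sub>0 c\<^sub>0 A B b. \<exists>\<epsilon>\<in>{1, -1}.
       b = (\<lambda>t. - \<epsilon> * sqrt c * t + c\<^sub>0) \<and>
       (\<forall>t. (A has_real_derivative sqrt k * cos (\<theta>\<^sub>0 - b t)) (at t)) \<and>
       (\<forall>t. (B has_real_derivative sqrt k * sin (\<theta>\<^sub>0 - b t)) (at t)) \<and>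
       (\<forall>(t, u)\<in>V.
          \<Phi> (rev_param f g t u) $ 1 = u * cos (b t) + A t \<and>
          \<Phi> (rev_param f g t u) $ 2 = - u * sin (b t) + B t)"
    if adm: "admissible_map s f g I U \<Phi>" and "k > 0" "c > 0"
      and q: "\<forall>(t, u)\<in>?D. (f u)\<^sup>2 = c * u\<^sup>2 + d * u + k" and V: "V \<in> components ?D" for \<Phi> c d k V
  proof -
    \<comment> \<open>A relatively open subset of a convex strip is locally connected, so its
      components are again relatively open, as a ruled map requires.\<close>
    have "locally connected ?D"
      by (rule locally_open_subset[OF convex_imp_locally_connected D])
         (intro convex_Times convex_real_interval convex_UNIV)
    then have V_open: "openin (top_of_set (?R \<times> UNIV)) V"
      using openin_components_locally_connected[OF _ V] D openin_trans by blast
    have VD: "V \<subseteq> ?D" "connected V" "V \<noteq> {}"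
      using V in_components_subset in_components_connected in_components_nonempty by blast+
    obtain Z' E' where ruled: "ruled_map ?R ?D f
        (\<lambda>p. plane_to_complex (\<Phi> (rev_param f g (fst p) (snd p)))) Z' E'"
      using ruled_map_admissible[OF assms(1) D adm] by blast
    have qV: "\<forall>(t, u)\<in>V. (f u)\<^sup>2 = c * u\<^sup>2 + d * u + k" using q VD(1) by blast
    obtain \<epsilon> \<theta>\<^sub>0 c\<^sub>0 C where \<epsilon>: "\<epsilon> \<in> {1, -1}" and
      Z: "\<And>t u. (t, u) \<in> V \<Longrightarrow> plane_to_complex (\<Phi> (rev_param f g t u)) =
        of_real u * cis (\<epsilon> * sqrt c * t - c\<^sub>0) +
        of_real (\<epsilon> * sqrt k / sqrt c) * (- \<i> * cis (\<theta>\<^sub>0 + (\<epsilon> * sqrt c * t - c\<^sub>0))) + C"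
      using ruled_map.global_form[OF ruled_map_subset[OF ruled V_open VD(1)] VD(2,3) \<open>c > 0\<close> \<open>k > 0\<close> qV]
      unfolding fst_conv snd_conv by metis
    define b where "b = (\<lambda>t. - \<epsilon> * sqrt c * t + c\<^sub>0)"
    \<comment> \<open>A and B are the real and imaginary parts of the t-dependent translation, since
      -i cis(x) = sin x - i cos x with x = \<open>\<theta>\<^sub>0 - b t\<close>.\<close>
    define A where "A = (\<lambda>t. \<epsilon> * sqrt k / sqrt c * sin (\<theta>\<^sub>0 - b t) + Re C)"
    define B where "B = (\<lambda>t. - (\<epsilon> * sqrt k / sqrt c) * cos (\<theta>\<^sub>0 - b t) + Im C)"
    have \<epsilon>2: "\<epsilon> * \<epsilon> = 1" using \<epsilon> by auto
    \<comment> \<open>The chain rule contributes \<epsilon> sqrt c, which cancels the prefactor of A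
      and B because \<epsilon>^2 = 1.\<close>
    have scale: "\<epsilon> * sqrt k / sqrt c * (x * (\<epsilon> * sqrt c)) = sqrt k * x" for x
      using \<open>c > 0\<close> \<epsilon>2 by (simp add: field_simps)
    have arg: "((\<lambda>t. \<theta>\<^sub>0 - b t) has_real_derivative \<epsilon> * sqrt c) (at t)" for t
      unfolding b_def by (auto intro!: derivative_eq_intros)
    have "(A has_real_derivative \<epsilon> * sqrt k / sqrt c * (cos (\<theta>\<^sub>0 - b t) * (\<epsilon> * sqrt c)) + 0) (at t)" for t
      unfolding A_def
      by (intro DERIV_add DERIV_cmult DERIV_const DERIV_fun_sin arg)
    then have A: "(A has_real_derivative sqrt k * cos (\<theta>\<^sub>0 - b t)) (at t)" for t
      by (simp only: scale add_0_right)
    have "(B has_real_derivative - (\<epsilon> * sqrt k / sqrt c) * (- sin (\<theta>\<^sub>0 - b t) * (\<epsilon> * sqrt c)) + 0) (at t)" for t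
      unfolding B_def
      by (intro DERIV_add DERIV_cmult DERIV_const DERIV_fun_cos arg)
    then have B: "(B has_real_derivative sqrt k * sin (\<theta>\<^sub>0 - b t)) (at t)" for t
      by (simp only: scale add_0_right mult_minus_left mult_minus_right minus_minus)
    have "\<Phi> (rev_param f g t u) $ 1 = u * cos (b t) + A t \<and>
          \<Phi> (rev_param f g t u) $ 2 = - u * sin (b t) + B t" if "(t, u) \<in> V" for t u
    proof -
      have arg': "\<epsilon> * sqrt c * t - c\<^sub>0 = - b t" by (simp add: b_def)
      note Z' = Z[OF that, unfolded arg']
      have "\<Phi> (rev_param f g t u) $ 1 = Re (plane_to_complex (\<Phi> (rev_param f g t u)))"
        "\<Phi> (rev_param f g t u) $ 2 = Im (plane_to_complex (\<Phi> (rev_param f g t u)))"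
        by (simp_all add: plane_to_complex_def)
      then show ?thesis unfolding Z' A_def B_def by simp
    qed
    then show ?thesis
      using A B \<epsilon> b_def by blast
  qed
  show ?thesis
  proof (intro conjI iffI allI impI ballI)
    assume "\<exists>\<Phi>. admissible_map s f g I U \<Phi>"
    then obtain \<Phi> where "admissible_map s f g I U \<Phi>" ..
    then show "\<exists>c d k. k > 0 \<and> c > 0 \<and> d\<^sup>2 \<le> 4 * c * k \<and>
        (\<forall>(t, u)\<in>?D. (f u)\<^sup>2 = c * u\<^sup>2 + d * u + k)"
      by (rule only_if)
  qed (elim exE conjE, rule if_part, assumption+, elim conjE, rule form, assumption+)
qed

end
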